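(* Let $X\sim\lambda$, where $\lambda$ is the unique stationary distribution of the Markov chain $(X_n^x)$ on $\mathbb{R}\cup\{\infty\}$ given by $X_n^x=h_{M_n}\circ\cdots\circ h_{M_1}(x)$. Then, for any $x\ge 0$, $$\Pr(X>x)=\Pr(X<-x)=\tfrac12\,\chi_{1/2}(x).$$
   Context: $(M_k)_{k\ge1}$ is an i.i.d. sequence of random matrices uniformly distributed on the nine matrices $E_0,\dots,E_8$ (taken up to sign), whose associated Moebius maps $h_i=h_{E_i}$, acting on $\mathbb{R}\cup\{\infty\}$, are $h_0(x)=-1/x$, $h_1(x)=1+x$, $h_2(x)=-1+x$, $h_3(x)=1-1/x$, $h_4(x)=-1-1/x$, $h_5(x)=x/(1+x)$, $h_6(x)=x/(1-x)$, $h_7(x)=-1/(1+x)$, $h_8(x)=1/(1-x)$. The chain $(X_n^x)$ has a unique stationary probability distribution on $\mathbb{R}\cup\{\infty\}$, by known results on random products of matrices. Every positive irrational number $y$ is written uniquely as $y=[k_0;k_1,k_2,\dots]=k_0+\frac{1}{k_1+\frac{1}{k_2+\cdots}}$ with $k_0\ge 0$ the integer part of $y$ and $k_1,k_2,\dots$ positive integers. The Denjoy-Minkowski function is $\chi_{1/2}([k_0;k_1,k_2,\dots])=\sum_{n=0}^\infty(-1)^n2^{-\sum_{j=0}^n k_j}$ at positive irrationals, extended by continuity to $[0,\infty)$. *)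

theory Defs
  imports "HOL-Probability.Probability"
begin

section \<open>The projective line and Moebius maps\<close>

text \<open>The extended line \<open>\<real> \<union> {\<infinity>}\<close> is the one-point compactification of the real line:
  \<open>Some x\<close> is the real number \<open>x\<close> and \<open>None\<close> is \<open>\<infinity>\<close>.\<close>

definition RP1 :: "real option topology" where
  "RP1 = Alexandroff_compactification euclideanreal"

definition borel_RP1 :: "real option measure" where
  "borel_RP1 = sigma (topspace RP1) {U. openin RP1 U}"

definition moebius :: "real^2^2 \<Rightarrow> real option \<Rightarrow> real option" where
  "moebius A z =
    (case z of
       None \<Rightarrow> if A$2$1 = 0 then None else Some (A$1$1 / A$2$1)
     | Some x \<Rightarrow> if A$2$1 * x + A$2$2 = 0 then None
                else Some ((A$1$1 * x + A$1$2) / (A$2$1 * x + A$2$2)))"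

text \<open>A matrix matters only up to sign, so one representative of each pair \<open>\<plusminus>E\<^sub>i\<close> is fixed.
  The lemmas \<open>moebius_uminus\<close>, \<open>inj_on_E\<close>, \<open>moebius_E_Some\<close> and \<open>moebius_E_None\<close> below
  confirm that this is harmless and that these matrices induce the intended maps.\<close>

definition mat2 :: "real \<Rightarrow> real \<Rightarrow> real \<Rightarrow> real \<Rightarrow> real^2^2" where
  "mat2 a b c d = vector [vector [a, b], vector [c, d]]"

definition E :: "nat \<Rightarrow> real^2^2" where
  "E i = [mat2 0 (-1) 1 0,
          mat2 1 1 0 1,
          mat2 1 (-1) 0 1,
          mat2 1 (-1) 1 0,
          mat2 (-1) (-1) 1 0,
          mat2 1 0 1 1,
          mat2 1 0 (-1) 1,
          mat2 0 (-1) 1 1,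
          mat2 0 1 (-1) 1] ! i"

lemma mat2_nth [simp]:
  "mat2 a b c d $ 1 $ 1 = a" "mat2 a b c d $ 1 $ 2 = b"
  "mat2 a b c d $ 2 $ 1 = c" "mat2 a b c d $ 2 $ 2 = d"
  by (simp_all add: mat2_def)

lemma moebius_uminus: "moebius (- A) z = moebius A z"
proof (cases z)
  case None
  then show ?thesis by (simp add: moebius_def)
next
  case (Some x)
  have den: "- (A$2$1 * x) - A$2$2 = - (A$2$1 * x + A$2$2)"
    and num: "- (A$1$1 * x) - A$1$2 = - (A$1$1 * x + A$1$2)" by simp_all
  show ?thesis
    unfolding Some moebius_def by (simp add: den num del: minus_add_distrib)
qed

lemma mat2_eq_iff:
  "mat2 a b c d = mat2 a' b' c' d' \<longleftrightarrow> a = a' \<and> b = b' \<and> c = c' \<and> d = d'"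
  by (metis mat2_nth)

lemma mat2_uminus: "- mat2 a b c d = mat2 (-a) (-b) (-c) (-d)"
  by (simp add: vec_eq_iff forall_2)

lemma inj_on_E: "i \<le> 8 \<Longrightarrow> j \<le> 8 \<Longrightarrow> E i = E j \<or> E i = - E j \<Longrightarrow> i = j"
  by (auto simp: E_def mat2_uminus mat2_eq_iff numeral_eq_Suc le_Suc_eq)

lemma moebius_E_Some:
  "moebius (E 0) (Some x) = (if x = 0 then None else Some (- 1 / x))"
  "moebius (E 1) (Some x) = Some (1 + x)"
  "moebius (E 2) (Some x) = Some (- 1 + x)"
  "moebius (E 3) (Some x) = (if x = 0 then None else Some (1 - 1 / x))"
  "moebius (E 4) (Some x) = (if x = 0 then None else Some (- 1 - 1 / x))"
  "moebius (E 5) (Some x) = (if x = - 1 then None else Some (x / (1 + x)))"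
  "moebius (E 6) (Some x) = (if x = 1 then None else Some (x / (1 - x)))"
  "moebius (E 7) (Some x) = (if x = - 1 then None else Some (- 1 / (1 + x)))"
  "moebius (E 8) (Some x) = (if x = 1 then None else Some (1 / (1 - x)))"
  by (auto simp: moebius_def E_def field_simps)

lemma moebius_E_None:
  "moebius (E 0) None = Some 0"
  "moebius (E 1) None = None"
  "moebius (E 2) None = None"
  "moebius (E 3) None = Some 1"
  "moebius (E 4) None = Some (- 1)"
  "moebius (E 5) None = Some 1"
  "moebius (E 6) None = Some (- 1)"
  "moebius (E 7) None = Some 0"
  "moebius (E 8) None = Some 0"
  by (simp_all add: moebius_def E_def)

section \<open>The random walk and its stationary distributions\<close>

definition iid_uniform_E :: "'w measure \<Rightarrow> (nat \<Rightarrow> 'w \<Rightarrow> real^2^2) \<Rightarrow> bool" where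
  "iid_uniform_E P M \<longleftrightarrow>
     prob_space P \<and>
     prob_space.indep_vars P (\<lambda>_. count_space (E ` {..8})) M {1..} \<and>
     (\<forall>k\<ge>1. distr P (count_space (E ` {..8})) (M k) = uniform_count_measure (E ` {..8}))"

primrec chain :: "(nat \<Rightarrow> 'w \<Rightarrow> real^2^2) \<Rightarrow> real option \<Rightarrow> nat \<Rightarrow> 'w \<Rightarrow> real option" where
  "chain M x 0 \<omega> = x"
| "chain M x (Suc n) \<omega> = moebius (M (Suc n) \<omega>) (chain M x n \<omega>)"

text \<open>Since the chain is time-homogeneous, its transition kernel is the law of its state at
  time 1.\<close>

definition stationary ::
  "'w measure \<Rightarrow> (nat \<Rightarrow> 'w \<Rightarrow> real^2^2) \<Rightarrow> real option measure \<Rightarrow> bool" where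
  "stationary P M L \<longleftrightarrow>
     prob_space L \<and> sets L = sets borel_RP1 \<and>
     (\<forall>A\<in>sets borel_RP1.
        emeasure L A = (\<integral>\<^sup>+ x. emeasure P {\<omega> \<in> space P. chain M x 1 \<omega> \<in> A} \<partial>L))"

section \<open>Continued fractions and the Denjoy-Minkowski function\<close>

primrec cf_convergent :: "(nat \<Rightarrow> nat) \<Rightarrow> nat \<Rightarrow> real" where
  "cf_convergent k 0 = real (k 0)"
| "cf_convergent k (Suc n) = real (k 0) + 1 / cf_convergent (\<lambda>i. k (Suc i)) n"

definition is_cf_expansion :: "(nat \<Rightarrow> nat) \<Rightarrow> real \<Rightarrow> bool" where
  "is_cf_expansion k y \<longleftrightarrow>
     int (k 0) = \<lfloor>y\<rfloor> \<and> (\<forall>n\<ge>1. k n \<ge> 1) \<and> cf_convergent k \<longlonglongrightarrow> y"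

definition cf_digits :: "real \<Rightarrow> nat \<Rightarrow> nat" where
  "cf_digits y = (THE k. is_cf_expansion k y)"

definition denjoy_minkowski_irr :: "real \<Rightarrow> real" where
  "denjoy_minkowski_irr y = (\<Sum>n. (- 1) ^ n / 2 ^ (\<Sum>j\<le>n. cf_digits y j))"

text \<open>Meaningful for arguments \<open>\<ge> 0\<close> only; at rationals the value is the limit along positive
  irrationals.\<close>

definition denjoy_minkowski :: "real \<Rightarrow> real" where
  "denjoy_minkowski y =
     (if 0 < y \<and> y \<notin> \<rat> then denjoy_minkowski_irr y
      else Lim (at y within {z. 0 < z \<and> z \<notin> \<rat>}) denjoy_minkowski_irr)"

end

theory Submission
  imports Defs
begin

text \<open>
  Write \<open>\<chi>\<close> for the Denjoy-Minkowski function and \<open>\<phi> x = L (x, \<infinity>)\<close> for the tail of a stationary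
  law \<open>L\<close>.  Stationarity, evaluated on the arcs \<open>(x, \<infinity>)\<close>, is a functional equation for \<open>\<phi>\<close>: nine times
  \<open>\<phi> x\<close> is the sum of the masses of the nine preimage arcs, and each of those is expressed through
  \<open>\<phi>\<close> at its two end points (\<open>balanced_tail\<close>).  For this the end points must carry no mass.
  They do not (\<open>stationary_point_mass_eq_0\<close>): an atom of maximal mass would force equal mass on all
  its preimages under the nine maps, and iterated preimages are infinitely many points.

  The function \<open>\<psi>\<close> that equals \<open>\<chi> x / 2\<close> for \<open>x \<ge> 0\<close> and \<open>1 - \<chi> (- x) / 2\<close> for \<open>x < 0\<close> satisfies the same
  equation (\<open>balanced_symmetric_tail\<close>).  This needs only \<open>\<chi> 0 = 1\<close>, \<open>\<chi> (x + 1) = \<chi> x / 2\<close> for \<open>x \<ge> 0\<close> and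
  \<open>\<chi> (1 / x) = 1 - \<chi> x\<close> for \<open>x > 0\<close>.  On irrationals the latter two are the effect on the defining series of
  increasing the integer part and of shifting the continued fraction expansion; at rationals they
  follow by passing to limits.

  The equation has one solution among continuous functions with limits \<open>1\<close> at \<open>- \<infinity>\<close> and \<open>0\<close> at \<open>\<infinity>\<close>
  (\<open>balanced_unique\<close>).  The difference \<open>d\<close> of two solutions is continuous on the circle
  \<open>\<real> \<union> {\<infinity>}\<close> with \<open>d \<infinity> = 0\<close>, and up to an additive constant, which turns out to be \<open>0\<close>, its value at \<open>x\<close> is the
  average of its values at the nine preimages of \<open>x\<close>.  So a maximum at a real \<open>x\<close> is also
  attained at the preimage \<open>x + 1\<close>, hence at \<open>x + n\<close> for all \<open>n\<close>; as \<open>d\<close> vanishes at infinity, the maximum is \<open>0\<close>.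
  By symmetry so is the minimum.

  That \<open>\<chi>\<close> has limits at all points of \<open>[0, \<infinity>)\<close>, and so a continuous extension, comes from the same two equations:
  they express \<open>\<chi>\<close> near any \<open>a > 0\<close> by half of \<open>\<chi>\<close> near another point, so its oscillation at
  every point is halved arbitrarily often (\<open>denjoy_minkowski_irr_oscillation\<close>).
\<close>

section \<open>Continued fractions of positive irrationals\<close>

abbreviation pos_irr :: "real set" where
  "pos_irr \<equiv> {z. 0 < z \<and> z \<notin> \<rat>}"

lemma pos_irr_add_1: "y \<in> pos_irr \<Longrightarrow> y + 1 \<in> pos_irr"
  using Rats_diff[of "y + 1" 1] by auto

lemma pos_irr_diff_1: "y \<in> pos_irr \<Longrightarrow> 1 < y \<Longrightarrow> y - 1 \<in> pos_irr"
  using Rats_add[of "y - 1" 1] by auto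

lemma pos_irr_inverse: "y \<in> pos_irr \<Longrightarrow> 1 / y \<in> pos_irr"
  using Rats_divide[of 1 "1 / y"] by auto

lemma frac_pos_irr: assumes "y \<in> pos_irr" shows "frac y \<in> pos_irr"
proof -
  have "y = frac y + of_int \<lfloor>y\<rfloor>" by (simp add: frac_def)
  with assms have irr: "frac y \<notin> \<rat>" by (metis (mono_tags, lifting) Rats_add Rats_of_int mem_Collect_eq)
  then have "frac y \<noteq> 0" by (metis Rats_0)
  with irr show ?thesis using frac_ge_0[of y] by (simp add: less_le)
qed

lemma inverse_frac_pos_irr:
  assumes "y \<in> pos_irr" shows "1 / frac y \<in> pos_irr" "1 < 1 / frac y"
  using pos_irr_inverse[OF frac_pos_irr[OF assms]] frac_pos_irr[OF assms] frac_lt_1[of y] by auto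

lemma cf_convergent_ge:
  assumes "\<And>n. 1 \<le> k n" shows "real (k 0) \<le> cf_convergent k n \<and> cf_convergent k n \<le> real (k 0) + 1"
  using assms
proof (induction n arbitrary: k)
  case (Suc n)
  have "1 \<le> cf_convergent (\<lambda>i. k (Suc i)) n"
    using Suc.IH[of "\<lambda>i. k (Suc i)"] Suc.prems[of 1] Suc.prems by fastforce
  then show ?case by simp
qed simp

text \<open>The tail expansion converges to \<open>1 / frac y\<close>, which therefore lies in
  \<open>[k 1, k 1 + 1]\<close>; irrationality excludes the right end point, so \<open>k 1\<close> is its integer part.
  This determines the digits one after the other.\<close>

lemma is_cf_expansion_tail:
  assumes y: "y \<in> pos_irr" and k: "is_cf_expansion k y"
  shows "is_cf_expansion (\<lambda>i. k (Suc i)) (1 / frac y)"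
proof -
  let ?k = "\<lambda>i. k (Suc i)" and ?y = "1 / frac y"
  note y' = inverse_frac_pos_irr[OF y]
  have pos: "1 \<le> ?k n" for n using k by (simp add: is_cf_expansion_def)
  have k0: "real (k 0) = of_int \<lfloor>y\<rfloor>" using k by (metis is_cf_expansion_def of_int_of_nat_eq)
  have "(\<lambda>n. cf_convergent k (Suc n)) \<longlonglongrightarrow> y"
    using k by (intro LIMSEQ_Suc) (simp add: is_cf_expansion_def)
  then have "(\<lambda>n. cf_convergent k (Suc n) - real (k 0)) \<longlonglongrightarrow> frac y"
    unfolding frac_def k0 by (intro tendsto_diff tendsto_const)
  then have "(\<lambda>n. 1 / (cf_convergent k (Suc n) - real (k 0))) \<longlonglongrightarrow> ?y"
    using y' by (intro tendsto_divide tendsto_const) auto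
  then have lim: "cf_convergent ?k \<longlonglongrightarrow> ?y" by simp
  have "real (k 1) \<le> ?y" "?y \<le> real (k 1) + 1"
    using cf_convergent_ge[of ?k, OF pos] tendsto_lowerbound[OF lim] tendsto_upperbound[OF lim] by auto
  moreover have "?y \<noteq> real (k 1) + 1"
    using y' by (metis (mono_tags, lifting) Rats_1 Rats_add Rats_of_nat mem_Collect_eq)
  ultimately have "\<lfloor>?y\<rfloor> = int (?k 0)" by (simp add: floor_eq_iff)
  with lim pos show ?thesis by (simp add: is_cf_expansion_def)
qed

lemma is_cf_expansion_unique:
  assumes "y \<in> pos_irr" "is_cf_expansion k y" "is_cf_expansion k' y"
  shows "k = k'"
proof
  show "k n = k' n" for n using assms
  proof (induction n arbitrary: k k' y)
    case 0
    then show ?case by (metis is_cf_expansion_def of_nat_eq_iff)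
  next
    case (Suc n)
    show ?case
      using Suc.IH[OF inverse_frac_pos_irr(1)[OF Suc.prems(1)]] is_cf_expansion_tail[OF Suc.prems(1)] Suc.prems
      by meson
  qed
qed

text \<open>The iterated map \<open>y \<mapsto> 1 / frac y\<close> is the Gauss map conjugated by inversion.\<close>

primrec gauss_digit :: "nat \<Rightarrow> real \<Rightarrow> nat" where
  "gauss_digit 0 y = nat \<lfloor>y\<rfloor>"
| "gauss_digit (Suc n) y = gauss_digit n (1 / frac y)"

lemma gauss_digit_ge_1: "y \<in> pos_irr \<Longrightarrow> 1 < y \<Longrightarrow> 1 \<le> gauss_digit n y"
proof (induction n arbitrary: y)
  case 0
  then show ?case by (simp add: le_nat_iff le_floor_iff)
next
  case (Suc n)
  then show ?case using inverse_frac_pos_irr[OF Suc.prems(1)] by simp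
qed

text \<open>Two steps of the expansion contract distances by a factor of at least \<open>4\<close>: with \<open>a \<ge> 1\<close> the map
  \<open>u \<mapsto> 1 / (a + 1 / u) = u / (a * u + 1)\<close> has difference quotient \<open>1 / ((a * u + 1) * (a * v + 1)) \<le> 1 / 4\<close> on \<open>[1, \<infinity>)\<close>.
  A single step need not contract, hence the induction in steps of two.\<close>

lemma gauss_digit_error:
  assumes "y \<in> pos_irr"
  shows "\<bar>cf_convergent (\<lambda>i. gauss_digit i y) n - y\<bar> \<le> 2 * (1 / 2) ^ n"
  using assms
proof (induction n arbitrary: y rule: induct_nat_012)
  case 0
  have "0 \<le> y - of_int \<lfloor>y\<rfloor>" "y - of_int \<lfloor>y\<rfloor> < 1" by linarith+
  with 0 show ?case by simp
next
  case 1
  let ?y = "1 / frac y"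
  note y' = inverse_frac_pos_irr[OF 1]
  have d: "1 \<le> real (gauss_digit 0 ?y)"
    using gauss_digit_ge_1[OF y', of 0] by (simp only: real_of_nat_ge_one_iff)
  have "y = of_int \<lfloor>y\<rfloor> + 1 / ?y" by (simp add: frac_def)
  moreover have "0 \<le> 1 / real (gauss_digit 0 ?y)" "1 / real (gauss_digit 0 ?y) \<le> 1"
    "0 \<le> 1 / ?y" "1 / ?y \<le> 1" using d frac_ge_0[of y] frac_lt_1[of y] by auto
  moreover have "cf_convergent (\<lambda>i. gauss_digit i y) (Suc 0) = of_int \<lfloor>y\<rfloor> + 1 / real (gauss_digit 0 ?y)"
    using 1 by simp
  ultimately have "\<bar>cf_convergent (\<lambda>i. gauss_digit i y) (Suc 0) - y\<bar> \<le> 1" by linarith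
  then show ?case by simp
next
  case (ge2 n)
  define y1 where "y1 = 1 / frac y"
  define y2 where "y2 = 1 / frac y1"
  define a where "a = real_of_int \<lfloor>y1\<rfloor>"
  define c where "c = cf_convergent (\<lambda>i. gauss_digit i y2) n"
  have y1: "y1 \<in> pos_irr" "1 < y1" unfolding y1_def using inverse_frac_pos_irr[OF ge2.prems] by auto
  have y2: "y2 \<in> pos_irr" "1 < y2" unfolding y2_def using inverse_frac_pos_irr[OF y1(1)] by auto
  have a: "1 \<le> a" unfolding a_def using y1 by simp
  have c: "1 \<le> c" unfolding c_def
    using cf_convergent_ge[of "\<lambda>i. gauss_digit i y2" n, OF gauss_digit_ge_1[OF y2]]
      gauss_digit_ge_1[OF y2, of 0]
    by linarith
  have eqy: "y = of_int \<lfloor>y\<rfloor> + 1 / (a + 1 / y2)"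
    using y1 by (simp add: y2_def y1_def frac_def a_def)
  have eqc: "cf_convergent (\<lambda>i. gauss_digit i y) (Suc (Suc n)) = of_int \<lfloor>y\<rfloor> + 1 / (a + 1 / c)"
    using ge2.prems y1 by (simp add: c_def y2_def y1_def a_def)
  have p: "0 < a * c + 1" "0 < a * y2 + 1" using a c y2 by (auto intro: add_nonneg_pos)
  have e: "1 / (a + 1 / c) = c / (a * c + 1)" "1 / (a + 1 / y2) = y2 / (a * y2 + 1)"
    using c y2 by (simp_all add: field_simps)
  have "1 / (a + 1 / c) - 1 / (a + 1 / y2) = (c - y2) / ((a * c + 1) * (a * y2 + 1))"
    unfolding e using p by (simp add: divide_simps) (simp add: algebra_simps)
  then have "\<bar>1 / (a + 1 / c) - 1 / (a + 1 / y2)\<bar> = \<bar>c - y2\<bar> / ((a * c + 1) * (a * y2 + 1))"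
    using p by (simp add: abs_mult)
  also have "\<dots> \<le> \<bar>c - y2\<bar> / 4"
  proof -
    have "2 \<le> a * c + 1" "2 \<le> a * y2 + 1" using mult_mono[of 1 a 1 c] mult_mono[of 1 a 1 y2] a c y2 by auto
    then have "2 * 2 \<le> (a * c + 1) * (a * y2 + 1)" by (intro mult_mono) auto
    then show ?thesis by (intro divide_left_mono) auto
  qed
  also have "\<dots> \<le> 2 * (1 / 2) ^ Suc (Suc n)" using ge2.IH(1)[OF y2(1)] by (simp add: c_def)
  finally show ?case unfolding eqc using eqy by linarith
qed

lemma is_cf_expansion_gauss_digit:
  assumes "y \<in> pos_irr" shows "is_cf_expansion (\<lambda>i. gauss_digit i y) y"
proof -
  have "(\<lambda>n. cf_convergent (\<lambda>i. gauss_digit i y) n - y) \<longlonglongrightarrow> 0"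
  proof (rule Lim_null_comparison)
    show "\<forall>\<^sub>F n in sequentially. norm (cf_convergent (\<lambda>i. gauss_digit i y) n - y) \<le> 2 * (1 / 2) ^ n"
      using gauss_digit_error[OF assms] by simp
    show "(\<lambda>n. 2 * (1 / 2) ^ n :: real) \<longlonglongrightarrow> 0" by (intro tendsto_mult_right_zero LIMSEQ_power_zero) simp
  qed
  then have "cf_convergent (\<lambda>i. gauss_digit i y) \<longlonglongrightarrow> y" using LIM_zero_iff by blast
  moreover have "1 \<le> gauss_digit n y" if "1 \<le> n" for n
    using that gauss_digit_ge_1[OF inverse_frac_pos_irr[OF assms]] by (cases n) auto
  ultimately show ?thesis using assms by (simp add: is_cf_expansion_def)
qed

lemma cf_digits_eqI: "y \<in> pos_irr \<Longrightarrow> is_cf_expansion k y \<Longrightarrow> cf_digits y = k"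
  unfolding cf_digits_def by (rule the_equality) (auto intro: is_cf_expansion_unique)

lemma is_cf_expansion_cf_digits: "y \<in> pos_irr \<Longrightarrow> is_cf_expansion (cf_digits y) y"
  using is_cf_expansion_gauss_digit cf_digits_eqI by metis

lemma cf_digits_add_1:
  assumes "y \<in> pos_irr" shows "cf_digits (y + 1) = (\<lambda>i. if i = 0 then cf_digits y 0 + 1 else cf_digits y i)"
proof (rule cf_digits_eqI[OF pos_irr_add_1[OF assms]])
  let ?k = "cf_digits y" and ?k' = "\<lambda>i. if i = 0 then cf_digits y 0 + 1 else cf_digits y i"
  have k: "is_cf_expansion ?k y" by (rule is_cf_expansion_cf_digits[OF assms])
  have "cf_convergent ?k' n = cf_convergent ?k n + 1" for n by (cases n) auto
  then have "cf_convergent ?k' = (\<lambda>n. cf_convergent ?k n + 1)" by auto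
  moreover have "(\<lambda>n. cf_convergent ?k n + 1) \<longlonglongrightarrow> y + 1"
    using k by (intro tendsto_add tendsto_const) (simp add: is_cf_expansion_def)
  ultimately show "is_cf_expansion ?k' (y + 1)" using k by (auto simp: is_cf_expansion_def)
qed

lemma cf_digits_inverse:
  assumes "y \<in> pos_irr" "1 < y" shows "cf_digits (1 / y) = case_nat 0 (cf_digits y)"
proof (rule cf_digits_eqI[OF pos_irr_inverse[OF assms(1)]])
  let ?k = "cf_digits y" and ?k' = "case_nat 0 (cf_digits y)"
  have k: "is_cf_expansion ?k y" by (rule is_cf_expansion_cf_digits[OF assms(1)])
  have "(\<lambda>n. 1 / cf_convergent ?k n) \<longlonglongrightarrow> 1 / y"
    using k assms by (intro tendsto_divide tendsto_const) (auto simp: is_cf_expansion_def)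
  then have "(\<lambda>n. cf_convergent ?k' (Suc n)) \<longlonglongrightarrow> 1 / y" by simp
  then have "cf_convergent ?k' \<longlonglongrightarrow> 1 / y" by (rule LIMSEQ_imp_Suc)
  moreover have "\<lfloor>1 / y\<rfloor> = 0" using assms by (simp add: floor_eq_iff)
  moreover have "1 \<le> ?k' n" if "1 \<le> n" for n
  proof -
    have "1 \<le> int (?k 0)" using k assms by (simp add: is_cf_expansion_def le_floor_iff)
    then have "1 \<le> ?k m" for m using k by (cases m) (auto simp: is_cf_expansion_def)
    then show ?thesis using that by (cases n) auto
  qed
  ultimately show "is_cf_expansion ?k' (1 / y)" by (auto simp: is_cf_expansion_def)
qed

section \<open>The Denjoy-Minkowski function at irrationals\<close>

abbreviation dm_term :: "real \<Rightarrow> nat \<Rightarrow> real" where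
  "dm_term y n \<equiv> (- 1) ^ n / 2 ^ (\<Sum>j\<le>n. cf_digits y j)"

lemma dm_term_bound:
  assumes "y \<in> pos_irr" shows "norm (dm_term y n) \<le> (1 / 2) ^ n"
proof -
  have "\<And>i. 1 \<le> i \<Longrightarrow> 1 \<le> cf_digits y i"
    using is_cf_expansion_cf_digits[OF assms] by (simp add: is_cf_expansion_def)
  then have "n \<le> (\<Sum>j\<le>n. cf_digits y j)"
  proof (induction n)
    case (Suc n)
    have "1 \<le> cf_digits y (Suc n)" using Suc.prems by simp
    moreover have "n \<le> (\<Sum>j\<le>n. cf_digits y j)" using Suc by blast
    ultimately show ?case by simp
  qed simp
  then have "(2::real) ^ n \<le> 2 ^ (\<Sum>j\<le>n. cf_digits y j)" by (intro power_increasing) auto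
  then show ?thesis by (simp add: norm_divide norm_power power_one_over frac_le)
qed

lemma dm_term_summable: "y \<in> pos_irr \<Longrightarrow> summable (dm_term y)"
  by (rule summable_comparison_test'[of "\<lambda>n. (1 / 2) ^ n"]) (use dm_term_bound in \<open>auto intro: summable_geometric simp del: norm_divide\<close>)

lemma denjoy_minkowski_irr_le_2:
  assumes "y \<in> pos_irr" shows "\<bar>denjoy_minkowski_irr y\<bar> \<le> 2"
proof -
  have "norm (\<Sum>n. dm_term y n) \<le> (\<Sum>n. (1 / 2) ^ n)"
    by (rule norm_suminf_le[OF dm_term_bound[OF assms]]) (auto intro: summable_geometric)
  also have "\<dots> = 2" by (subst suminf_geometric) auto
  finally show ?thesis by (simp add: denjoy_minkowski_irr_def)
qed

lemma denjoy_minkowski_irr_add_1: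
  assumes "y \<in> pos_irr" shows "denjoy_minkowski_irr (y + 1) = denjoy_minkowski_irr y / 2"
proof -
  have "(\<Sum>j\<le>n. cf_digits (y + 1) j) = Suc (\<Sum>j\<le>n. cf_digits y j)" for n
    by (induction n) (auto simp: cf_digits_add_1[OF assms])
  then have "dm_term (y + 1) n = dm_term y n / 2" for n by simp
  then show ?thesis
    unfolding denjoy_minkowski_irr_def using suminf_divide[OF dm_term_summable[OF assms]] by simp
qed

lemma denjoy_minkowski_irr_inverse_gt_1:
  assumes "y \<in> pos_irr" "1 < y" shows "denjoy_minkowski_irr (1 / y) = 1 - denjoy_minkowski_irr y"
proof -
  have "(\<Sum>j\<le>Suc n. cf_digits (1 / y) j) = (\<Sum>j\<le>n. cf_digits y j)" for n
    by (simp add: cf_digits_inverse[OF assms] sum.atMost_Suc_shift del: sum.atMost_Suc)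
  then have "dm_term (1 / y) (Suc n) = - dm_term y n" for n by simp
  moreover have "dm_term (1 / y) 0 = 1" by (simp add: cf_digits_inverse[OF assms])
  ultimately show ?thesis
    unfolding denjoy_minkowski_irr_def
    using suminf_split_head[OF dm_term_summable[OF pos_irr_inverse[OF assms(1)]]]
      suminf_minus[OF dm_term_summable[OF assms(1)]] by simp
qed

lemma denjoy_minkowski_irr_inverse:
  assumes "y \<in> pos_irr" shows "denjoy_minkowski_irr (1 / y) = 1 - denjoy_minkowski_irr y"
proof (cases "1 < y")
  case False
  with assms have "y < 1" by (auto simp: not_less less_le)
  then have "1 < 1 / y" using assms by simp
  from denjoy_minkowski_irr_inverse_gt_1[OF pos_irr_inverse[OF assms] this] show ?thesis by simp
qed (rule denjoy_minkowski_irr_inverse_gt_1[OF assms])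

text \<open>Iterating \<open>denjoy_minkowski_irr_add_1\<close>; together with inversion this controls the
  function at infinity and at \<open>0\<close>.\<close>

lemma denjoy_minkowski_irr_decay:
  "y \<in> pos_irr \<Longrightarrow> real n \<le> y \<Longrightarrow> \<bar>denjoy_minkowski_irr y\<bar> \<le> 2 * (1 / 2) ^ n"
proof (induction n arbitrary: y)
  case 0
  then show ?case using denjoy_minkowski_irr_le_2 by simp
next
  case (Suc n)
  have "y \<noteq> 1" using Suc.prems by auto
  then have 1: "y - 1 \<in> pos_irr" using pos_irr_diff_1 Suc.prems by auto
  show ?case using Suc.IH[OF 1] denjoy_minkowski_irr_add_1[OF 1] Suc.prems by simp
qed

section \<open>Continuity of the Denjoy-Minkowski function\<close>

text \<open>Approach through positive irrationals with the limit point itself included, unlike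
  \<open>at a within pos_irr\<close>: the limit at an irrational \<open>a\<close> along this filter is then the value at \<open>a\<close>.\<close>

abbreviation near_irr :: "real \<Rightarrow> real filter" where
  "near_irr a \<equiv> inf (nhds a) (principal pos_irr)"

lemma near_irr_nontrivial:
  assumes "0 \<le> a" shows "near_irr a \<noteq> bot"
proof -
  have "\<exists>y\<in>S. y \<in> pos_irr" if S: "open S" "a \<in> S" for S
  proof -
    obtain e where e: "0 < e" "ball a e \<subseteq> S" using S by (meson open_contains_ball)
    have "uncountable ({a<..<a + e} - \<rat>)"
      using uncountable_minus_countable[OF uncountable_open_interval[THEN iffD2] countable_rat] e by simp
    then have "{a<..<a + e} - \<rat> \<noteq> {}" by (metis countable_empty)
    then obtain y where "y \<in> {a<..<a + e}" "y \<notin> \<rat>" by blast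
    moreover then have "y \<in> S" using e by (auto simp: dist_real_def intro: subsetD[of "ball a e"])
    ultimately show ?thesis using assms by (intro bexI[of _ y]) auto
  qed
  then show ?thesis
    unfolding trivial_limit_def eventually_inf_principal eventually_nhds by blast
qed

lemma eventually_near_irrI: "\<forall>\<^sub>F y in nhds a. y \<in> pos_irr \<longrightarrow> Q y \<Longrightarrow> eventually Q (near_irr a)"
  by (simp add: eventually_inf_principal)

lemma filterlim_near_irr:
  assumes "isCont g a" "\<forall>\<^sub>F y in near_irr a. g y \<in> pos_irr"
  shows "filterlim g (near_irr (g a)) (near_irr a)"
proof -
  have "filterlim g (nhds (g a)) (nhds a)" using assms(1) by (simp add: continuous_at tendsto_at_iff_tendsto_nhds)
  then have "filterlim g (nhds (g a)) (near_irr a)" by (rule filterlim_mono) auto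
  with assms(2) show ?thesis by (simp add: filterlim_inf filterlim_principal)
qed

lemma eventually_near_irr_less: "a < b \<Longrightarrow> \<forall>\<^sub>F y in near_irr a. y < b"
  by (rule eventually_near_irrI) (auto intro: eventually_mono[OF order_tendstoD(2)[OF filterlim_ident]])

lemma eventually_near_irr_greater: "b < a \<Longrightarrow> \<forall>\<^sub>F y in near_irr a. b < y"
  by (rule eventually_near_irrI) (auto intro: eventually_mono[OF order_tendstoD(1)[OF filterlim_ident]])

lemma eventually_near_irr_mem: "\<forall>\<^sub>F y in near_irr a. y \<in> pos_irr"
  by (rule eventually_near_irrI) simp

lemma denjoy_minkowski_irr_near_0: "(denjoy_minkowski_irr \<longlongrightarrow> 1) (near_irr 0)"
proof (rule tendstoI)
  fix e :: real assume "0 < e"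
  have "(\<lambda>n. 2 * (1 / 2) ^ n :: real) \<longlonglongrightarrow> 0" by (intro tendsto_mult_right_zero LIMSEQ_power_zero) simp
  then have "\<forall>\<^sub>F n in sequentially. 2 * (1 / 2) ^ n < e" using \<open>0 < e\<close> order_tendstoD(2) by blast
  then obtain n where n: "2 * (1 / 2) ^ n < e" by (auto simp: eventually_sequentially)
  have "\<forall>\<^sub>F y in near_irr 0. y < 1 / real (Suc n)" by (rule eventually_near_irr_less) simp
  then show "\<forall>\<^sub>F y in near_irr 0. dist (denjoy_minkowski_irr y) 1 < e"
    using eventually_near_irr_mem
  proof eventually_elim
    case (elim y)
    then have "real n \<le> 1 / y" by (simp add: field_simps)
    then show ?case
      using denjoy_minkowski_irr_decay[OF pos_irr_inverse[of y], of n] denjoy_minkowski_irr_inverse[of y] elim n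
      by (auto simp: dist_real_def)
  qed
qed

text \<open>Near \<open>a > 1\<close> the function is half its translate near \<open>a - 1\<close>; near \<open>a\<close> with \<open>0 < a < 1\<close> it is
  \<open>1 - \<chi> (1 / y - 1) / 2\<close> with \<open>1 / y - 1\<close> near \<open>1 / a - 1 > 0\<close>.  Either way the approximation error is
  halved.  Near \<open>a = 1\<close> one of the two formulas applies on each side, both have argument near \<open>0\<close>, where
  the function tends to \<open>1\<close> (\<open>denjoy_minkowski_irr_near_0\<close>), and both give \<open>1 / 2\<close>.\<close>

lemma denjoy_minkowski_irr_oscillation:
  "0 \<le> a \<Longrightarrow> \<exists>l. \<forall>\<^sub>F y in near_irr a. \<bar>denjoy_minkowski_irr y - l\<bar> \<le> 2 * (1 / 2) ^ n"
proof (induction n arbitrary: a)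
  case 0
  show ?case
    by (rule exI[of _ 0], rule eventually_near_irrI) (use denjoy_minkowski_irr_le_2 in auto)
next
  case (Suc n)
  let ?f = denjoy_minkowski_irr
  have right: "?f y = ?f (y - 1) / 2" if "y \<in> pos_irr" "1 < y" for y
    using denjoy_minkowski_irr_add_1[OF pos_irr_diff_1[OF that]] by simp
  have left: "1 / y - 1 \<in> pos_irr" "?f y = 1 - ?f (1 / y - 1) / 2" if y: "y \<in> pos_irr" "y < 1" for y
  proof -
    have 1: "1 < 1 / y" using y by simp
    show "1 / y - 1 \<in> pos_irr" using pos_irr_diff_1[OF pos_irr_inverse[OF y(1)] 1] .
    show "?f y = 1 - ?f (1 / y - 1) / 2"
      using right[OF pos_irr_inverse[OF y(1)] 1] denjoy_minkowski_irr_inverse[OF y(1)] by simp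
  qed
  consider "a = 0" | "0 < a" "a < 1" | "a = 1" | "1 < a" using Suc.prems by linarith
  then show ?case
  proof cases
    case 1
    have "\<forall>\<^sub>F y in near_irr 0. dist (?f y) 1 < 2 * (1 / 2) ^ Suc n"
      by (rule tendstoD[OF denjoy_minkowski_irr_near_0]) simp
    then show ?thesis unfolding 1 dist_real_def by (intro exI[of _ 1]) (auto elim: eventually_mono)
  next
    case 2
    obtain l where l: "\<forall>\<^sub>F y in near_irr (1 / a - 1). \<bar>?f y - l\<bar> \<le> 2 * (1 / 2) ^ n"
      using Suc.IH[of "1 / a - 1"] 2 by auto
    have ev: "\<forall>\<^sub>F y in near_irr a. y \<in> pos_irr \<and> y < 1"
      using eventually_near_irr_mem eventually_near_irr_less[OF 2(2)] by (rule eventually_conj)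
    have "filterlim (\<lambda>y. 1 / y - 1) (near_irr (1 / a - 1)) (near_irr a)"
      by (rule filterlim_near_irr) (use 2 left in \<open>auto intro!: continuous_intros eventually_mono[OF ev]\<close>)
    from eventually_compose_filterlim[OF l this] ev
    have "\<forall>\<^sub>F y in near_irr a. \<bar>?f y - (1 - l / 2)\<bar> \<le> 2 * (1 / 2) ^ Suc n"
    proof eventually_elim
      case (elim y)
      then show ?case using left(2)[of y] by (simp add: abs_le_iff)
    qed
    then show ?thesis by blast
  next
    case 3
    have "\<forall>\<^sub>F y in near_irr 0. dist (?f y) 1 < 2 * (1 / 2) ^ n"
      by (rule tendstoD[OF denjoy_minkowski_irr_near_0]) simp
    then have 0: "\<forall>\<^sub>F y in nhds 0. y \<in> pos_irr \<longrightarrow> \<bar>?f y - 1\<bar> < 2 * (1 / 2) ^ n"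
      by (simp add: eventually_inf_principal dist_real_def)
    have "((\<lambda>y. y - 1) \<longlongrightarrow> 0) (nhds (1::real))" "((\<lambda>y. 1 / y - 1) \<longlongrightarrow> 0) (nhds (1::real))"
      by (auto intro!: tendsto_eq_intros filterlim_ident)
    note this[THEN eventually_compose_filterlim[OF 0]]
    then have "\<forall>\<^sub>F y in nhds 1. y \<in> pos_irr \<longrightarrow> \<bar>?f y - 1 / 2\<bar> \<le> 2 * (1 / 2) ^ Suc n"
    proof eventually_elim
      case (elim y)
      show ?case
      proof
        assume y: "y \<in> pos_irr"
        then have "y \<noteq> 1" by auto
        then consider "1 < y" | "y < 1" by linarith
        then show "\<bar>?f y - 1 / 2\<bar> \<le> 2 * (1 / 2) ^ Suc n"
        proof cases
          case 1
          then show ?thesis using elim(1) right[OF y 1] pos_irr_diff_1[OF y 1] by (auto simp: abs_le_iff abs_less_iff)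
        next
          case 2
          then show ?thesis using elim(2) left[OF y 2] by (auto simp: abs_le_iff abs_less_iff)
        qed
      qed
    qed
    then show ?thesis unfolding 3 by (intro exI[of _ "1 / 2"] eventually_near_irrI)
  next
    case 4
    obtain l where l: "\<forall>\<^sub>F y in near_irr (a - 1). \<bar>?f y - l\<bar> \<le> 2 * (1 / 2) ^ n"
      using Suc.IH[of "a - 1"] 4 by auto
    have ev: "\<forall>\<^sub>F y in near_irr a. y \<in> pos_irr \<and> 1 < y"
      using eventually_near_irr_mem eventually_near_irr_greater[OF 4] by (rule eventually_conj)
    have "filterlim (\<lambda>y. y - 1) (near_irr (a - 1)) (near_irr a)"
      by (rule filterlim_near_irr) (use pos_irr_diff_1 in \<open>auto intro!: continuous_intros eventually_mono[OF ev]\<close>)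
    from eventually_compose_filterlim[OF l this] ev
    have "\<forall>\<^sub>F y in near_irr a. \<bar>?f y - l / 2\<bar> \<le> 2 * (1 / 2) ^ Suc n"
    proof eventually_elim
      case (elim y)
      then show ?case using right[of y] by (simp add: abs_le_iff)
    qed
    then show ?thesis by blast
  qed
qed

text \<open>The approximate limits for the errors \<open>2 * (1 / 2) ^ n\<close> form a Cauchy sequence.\<close>

lemma denjoy_minkowski_irr_convergent:
  assumes a: "0 \<le> a" shows "\<exists>l. (denjoy_minkowski_irr \<longlongrightarrow> l) (near_irr a)"
proof -
  let ?f = denjoy_minkowski_irr
  define \<epsilon> :: "nat \<Rightarrow> real" where "\<epsilon> n = 2 * (1 / 2) ^ n" for n
  have \<epsilon>: "\<epsilon> \<longlonglongrightarrow> 0" unfolding \<epsilon>_def by (intro tendsto_mult_right_zero LIMSEQ_power_zero) simp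
  obtain l where l: "\<And>n. \<forall>\<^sub>F y in near_irr a. \<bar>?f y - l n\<bar> \<le> \<epsilon> n"
    unfolding \<epsilon>_def using denjoy_minkowski_irr_oscillation[OF a] by metis
  have close: "\<bar>l m - l n\<bar> \<le> \<epsilon> m + \<epsilon> n" for m n
  proof -
    have "\<forall>\<^sub>F y in near_irr a. \<bar>l m - l n\<bar> \<le> \<epsilon> m + \<epsilon> n"
      using l[of m] l[of n] by eventually_elim linarith
    then show ?thesis using near_irr_nontrivial[OF a] by simp
  qed
  have small: "\<exists>N. \<forall>n\<ge>N. \<epsilon> n < e" if "0 < e" for e
    using order_tendstoD(2)[OF \<epsilon> that] by (simp add: eventually_sequentially)
  have "Cauchy l"
  proof (rule metric_CauchyI)
    fix e :: real assume "0 < e"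
    then obtain N where N: "\<And>n. n \<ge> N \<Longrightarrow> \<epsilon> n < e / 2" using small[of "e / 2"] by auto
    have "dist (l m) (l n) < e" if "N \<le> m" "N \<le> n" for m n
      using close[of m n] N[OF that(1)] N[OF that(2)] by (simp add: dist_real_def)
    then show "\<exists>N. \<forall>m\<ge>N. \<forall>n\<ge>N. dist (l m) (l n) < e" by blast
  qed
  then obtain c where c: "l \<longlonglongrightarrow> c" using Cauchy_convergent convergentD by blast
  have "(?f \<longlongrightarrow> c) (near_irr a)"
  proof (rule tendstoI)
    fix e :: real assume "0 < e"
    then obtain N where N: "\<And>n. n \<ge> N \<Longrightarrow> \<epsilon> n < e / 2" using small[of "e / 2"] by auto
    have "\<forall>\<^sub>F n in sequentially. dist (l n) c < e / 2" using tendstoD[OF c, of "e / 2"] \<open>0 < e\<close> by simp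
    then have "\<forall>\<^sub>F n in sequentially. N \<le> n \<and> dist (l n) c < e / 2"
      using eventually_ge_at_top[of N] by eventually_elim simp
    then obtain n where n: "n \<ge> N" "dist (l n) c < e / 2" using eventually_happens' sequentially_bot by blast
    show "\<forall>\<^sub>F y in near_irr a. dist (?f y) c < e"
      using l[of n] by eventually_elim (use N[OF n(1)] n(2) in \<open>unfold dist_real_def, linarith\<close>)
  qed
  then show ?thesis by blast
qed

lemma denjoy_minkowski_limit:
  assumes a: "0 \<le> a" shows "(denjoy_minkowski_irr \<longlongrightarrow> denjoy_minkowski a) (near_irr a)"
proof -
  obtain l where l: "(denjoy_minkowski_irr \<longlongrightarrow> l) (near_irr a)"
    using denjoy_minkowski_irr_convergent[OF a] by blast
  have "denjoy_minkowski a = l"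
  proof (cases "a \<in> pos_irr")
    case True
    have "dist (denjoy_minkowski_irr a) l < e" if "0 < e" for e
      using eventually_nhds_x_imp_x[OF tendstoD[OF l that, unfolded eventually_inf_principal]] True by simp
    then have "denjoy_minkowski_irr a = l" by (metis dist_pos_lt less_irrefl)
    then show ?thesis using True by (simp add: denjoy_minkowski_def)
  next
    case False
    then have eq: "at a within pos_irr = near_irr a" by (auto simp: at_within_def)
    have "Lim (at a within pos_irr) denjoy_minkowski_irr = l"
      unfolding eq by (rule tendsto_Lim[OF near_irr_nontrivial[OF a] l])
    then show ?thesis using False unfolding denjoy_minkowski_def by auto
  qed
  with l show ?thesis by simp
qed

lemma denjoy_minkowski_eqI:
  assumes "0 \<le> a" "(denjoy_minkowski_irr \<longlongrightarrow> l) (near_irr a)" shows "denjoy_minkowski a = l"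
  using tendsto_unique[OF near_irr_nontrivial denjoy_minkowski_limit] assms by blast

lemma denjoy_minkowski_0: "denjoy_minkowski 0 = 1"
  by (rule denjoy_minkowski_eqI[OF _ denjoy_minkowski_irr_near_0]) simp

lemma denjoy_minkowski_add_1:
  assumes "0 \<le> x" shows "denjoy_minkowski (x + 1) = denjoy_minkowski x / 2"
proof -
  have "filterlim (\<lambda>y. y + 1) (near_irr (x + 1)) (near_irr x)"
    by (rule filterlim_near_irr)
      (auto intro!: continuous_intros eventually_mono[OF eventually_near_irr_mem] simp: pos_irr_add_1[simplified])
  from filterlim_compose[OF denjoy_minkowski_limit this] assms
  have "((\<lambda>y. denjoy_minkowski_irr (y + 1)) \<longlongrightarrow> denjoy_minkowski (x + 1)) (near_irr x)" by simp
  moreover have "((\<lambda>y. denjoy_minkowski_irr (y + 1)) \<longlongrightarrow> denjoy_minkowski x / 2) (near_irr x)"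
    using tendsto_divide[OF denjoy_minkowski_limit[OF assms] tendsto_const[of 2]]
    by (rule Lim_transform_eventually)
      (auto intro!: eventually_mono[OF eventually_near_irr_mem] simp: denjoy_minkowski_irr_add_1)
  ultimately show ?thesis using tendsto_unique near_irr_nontrivial[OF assms] by blast
qed

lemma denjoy_minkowski_inverse:
  assumes "0 < x" shows "denjoy_minkowski (1 / x) = 1 - denjoy_minkowski x"
proof -
  have x: "0 \<le> x" "0 \<le> 1 / x" using assms by auto
  have "filterlim (\<lambda>y. 1 / y) (near_irr (1 / x)) (near_irr x)"
    by (rule filterlim_near_irr)
      (use assms pos_irr_inverse in \<open>auto intro!: continuous_intros eventually_mono[OF eventually_near_irr_mem]\<close>)
  from filterlim_compose[OF denjoy_minkowski_limit[OF x(2)] this]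
  have "((\<lambda>y. denjoy_minkowski_irr (1 / y)) \<longlongrightarrow> denjoy_minkowski (1 / x)) (near_irr x)" by simp
  moreover have "((\<lambda>y. denjoy_minkowski_irr (1 / y)) \<longlongrightarrow> 1 - denjoy_minkowski x) (near_irr x)"
    using tendsto_diff[OF tendsto_const[of 1] denjoy_minkowski_limit[OF x(1)]]
    by (rule Lim_transform_eventually)
      (auto intro!: eventually_mono[OF eventually_near_irr_mem] simp: denjoy_minkowski_irr_inverse)
  ultimately show ?thesis using tendsto_unique near_irr_nontrivial[OF x(1)] by blast
qed

text \<open>If the values at the irrationals near \<open>a\<close> are within \<open>e / 2\<close> of the limit at \<open>a\<close>, then so are
  their limits at all points near \<open>a\<close>.\<close>

lemma continuous_on_denjoy_minkowski: "continuous_on {0..} denjoy_minkowski"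
proof -
  have "(denjoy_minkowski \<longlongrightarrow> denjoy_minkowski a) (at a within {0..})" if a: "0 \<le> a" for a
  proof (rule tendstoI)
    fix e :: real assume e: "0 < e"
    have "\<forall>\<^sub>F y in nhds a. y \<in> pos_irr \<longrightarrow> dist (denjoy_minkowski_irr y) (denjoy_minkowski a) < e / 2"
      using tendstoD[OF denjoy_minkowski_limit[OF a], of "e / 2"] e by (simp add: eventually_inf_principal)
    then have "\<forall>\<^sub>F b in nhds a. \<forall>\<^sub>F y in near_irr b. dist (denjoy_minkowski_irr y) (denjoy_minkowski a) < e / 2"
      unfolding eventually_inf_principal by (subst eventually_eventually)
    then have "\<forall>\<^sub>F b in nhds a. 0 \<le> b \<longrightarrow> dist (denjoy_minkowski b) (denjoy_minkowski a) < e"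
    proof eventually_elim
      case (elim b)
      show ?case
      proof
        assume b: "0 \<le> b"
        have "dist (denjoy_minkowski b) (denjoy_minkowski a) \<le> e / 2"
          by (rule tendsto_upperbound[OF tendsto_dist[OF denjoy_minkowski_limit[OF b] tendsto_const] _ near_irr_nontrivial[OF b]])
            (use elim in \<open>auto elim: eventually_mono\<close>)
        then show "dist (denjoy_minkowski b) (denjoy_minkowski a) < e" using e by simp
      qed
    qed
    then show "\<forall>\<^sub>F b in at a within {0..}. dist (denjoy_minkowski b) (denjoy_minkowski a) < e"
      by (auto simp: eventually_at_filter elim: eventually_mono)
  qed
  then show ?thesis by (simp add: continuous_on_def)
qed

lemma denjoy_minkowski_at_top: "(denjoy_minkowski \<longlongrightarrow> 0) at_top"
proof (rule tendstoI)
  fix e :: real assume "0 < e"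
  have "(\<lambda>n. 2 * (1 / 2) ^ n :: real) \<longlonglongrightarrow> 0" by (intro tendsto_mult_right_zero LIMSEQ_power_zero) simp
  then have "\<forall>\<^sub>F n in sequentially. 2 * (1 / 2) ^ n < e" using \<open>0 < e\<close> order_tendstoD(2) by blast
  then obtain n where n: "2 * (1 / 2) ^ n < e" by (auto simp: eventually_sequentially)
  show "\<forall>\<^sub>F x in at_top. dist (denjoy_minkowski x) 0 < e"
    using eventually_gt_at_top[of "real n"]
  proof eventually_elim
    case (elim x)
    then have x: "0 \<le> x" by linarith
    have "\<forall>\<^sub>F y in near_irr x. \<bar>denjoy_minkowski_irr y\<bar> \<le> 2 * (1 / 2) ^ n"
      using eventually_near_irr_mem eventually_near_irr_greater[OF elim]
      by eventually_elim (rule denjoy_minkowski_irr_decay, auto)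
    then have "\<bar>denjoy_minkowski x\<bar> \<le> 2 * (1 / 2) ^ n"
      by (rule tendsto_upperbound[OF tendsto_rabs[OF denjoy_minkowski_limit[OF x]] _ near_irr_nontrivial[OF x]])
    with n show ?case by simp
  qed
qed

section \<open>A maximum principle for the stationarity equation\<close>

text \<open>The value of \<open>d\<close>, extended by \<open>d \<infinity> = 0\<close>, at the point that the map \<open>r \<mapsto> - 1 / (r + a)\<close> sends to \<open>t\<close>;
  for \<open>t = 0\<close> this point is \<open>\<infinity>\<close>.\<close>

definition at_preimage :: "(real \<Rightarrow> real) \<Rightarrow> real \<Rightarrow> real \<Rightarrow> real" where
  "at_preimage d t a = (if t = 0 then 0 else d (- 1 / t - a))"

text \<open>The mass of \<open>{r. - 1 / (r + a) > t}\<close> under an atomless law with tail function \<open>\<phi>\<close>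
  (see \<open>measure_inverted_ray\<close> below).  This arc runs from \<open>- 1 / t - a\<close> up to \<open>- a\<close>; it passes through \<open>\<infinity>\<close>
  exactly if \<open>t < 0\<close>, and begins there if \<open>t = 0\<close>, which accounts for the summand \<open>1\<close>.\<close>

definition arc_mass :: "(real \<Rightarrow> real) \<Rightarrow> real \<Rightarrow> real \<Rightarrow> real" where
  "arc_mass \<phi> t a = (if t = 0 then 0 else \<phi> (- 1 / t - a)) - \<phi> (- a) + (if t \<le> 0 then 1 else 0)"

text \<open>Stationarity of the law with tail function \<open>\<phi>\<close>, tested on the rays \<open>(x, \<infinity>)\<close>.  Apart from the
  translations, each of the nine maps has the form \<open>r \<mapsto> - 1 / (r + a) + s\<close> with \<open>a, s \<in> {- 1, 0, 1}\<close>.\<close>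

definition balanced :: "(real \<Rightarrow> real) \<Rightarrow> bool" where
  "balanced \<phi> \<longleftrightarrow> (\<forall>x. 9 * \<phi> x = \<phi> (x - 1) + \<phi> (x + 1)
     + arc_mass \<phi> x 0 + arc_mass \<phi> (x - 1) 0 + arc_mass \<phi> (x + 1) 0
     + arc_mass \<phi> x 1 + arc_mass \<phi> x (- 1)
     + arc_mass \<phi> (x - 1) 1 + arc_mass \<phi> (x + 1) (- 1))"

text \<open>The equation satisfied by the difference of two balanced functions.  The indicator terms of the arcs
  cancel, and the fixed end points \<open>- a\<close> of the arcs contribute the additive constant.\<close>

definition balanced_diff :: "(real \<Rightarrow> real) \<Rightarrow> bool" where
  "balanced_diff d \<longleftrightarrow> (\<forall>x. 9 * d x + (3 * d 0 + 2 * d 1 + 2 * d (- 1)) = d (x - 1) + d (x + 1)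
     + at_preimage d x 0 + at_preimage d (x - 1) 0 + at_preimage d (x + 1) 0
     + at_preimage d x 1 + at_preimage d x (- 1)
     + at_preimage d (x - 1) 1 + at_preimage d (x + 1) (- 1))"

lemma balanced_diffD:
  assumes "balanced_diff d"
  shows "9 * d x + (3 * d 0 + 2 * d 1 + 2 * d (- 1)) = d (x - 1) + d (x + 1)
     + at_preimage d x 0 + at_preimage d (x - 1) 0 + at_preimage d (x + 1) 0
     + at_preimage d x 1 + at_preimage d x (- 1)
     + at_preimage d (x - 1) 1 + at_preimage d (x + 1) (- 1)"
  using assms unfolding balanced_diff_def by blast

lemma balanced_diff_diff:
  assumes "balanced \<phi>" "balanced \<psi>" shows "balanced_diff (\<lambda>x. \<phi> x - \<psi> x)"
proof -
  have e: "at_preimage (\<lambda>x. \<phi> x - \<psi> x) t a = arc_mass \<phi> t a - arc_mass \<psi> t a + (\<phi> (- a) - \<psi> (- a))" for t a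
    by (simp add: at_preimage_def arc_mass_def)
  show ?thesis unfolding balanced_diff_def
  proof
    fix x
    show "9 * (\<phi> x - \<psi> x) + (3 * (\<phi> 0 - \<psi> 0) + 2 * (\<phi> 1 - \<psi> 1) + 2 * (\<phi> (- 1) - \<psi> (- 1))) =
      \<phi> (x - 1) - \<psi> (x - 1) + (\<phi> (x + 1) - \<psi> (x + 1))
     + at_preimage (\<lambda>x. \<phi> x - \<psi> x) x 0 + at_preimage (\<lambda>x. \<phi> x - \<psi> x) (x - 1) 0 + at_preimage (\<lambda>x. \<phi> x - \<psi> x) (x + 1) 0
     + at_preimage (\<lambda>x. \<phi> x - \<psi> x) x 1 + at_preimage (\<lambda>x. \<phi> x - \<psi> x) x (- 1)
     + at_preimage (\<lambda>x. \<phi> x - \<psi> x) (x - 1) 1 + at_preimage (\<lambda>x. \<phi> x - \<psi> x) (x + 1) (- 1)"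
      using assms[unfolded balanced_def, THEN spec, of x] by (simp add: e)
  qed
qed

lemma balanced_diff_uminus:
  assumes "balanced_diff d" shows "balanced_diff (\<lambda>x. - d x)"
proof -
  have e: "at_preimage (\<lambda>x. - d x) t a = - at_preimage d t a" for t a by (simp add: at_preimage_def)
  show ?thesis unfolding balanced_diff_def e
  proof
    fix x
    show "9 * - d x + (3 * - d 0 + 2 * - d 1 + 2 * - d (- 1)) = - d (x - 1) + - d (x + 1)
     + - at_preimage d x 0 + - at_preimage d (x - 1) 0 + - at_preimage d (x + 1) 0
     + - at_preimage d x 1 + - at_preimage d x (- 1)
     + - at_preimage d (x - 1) 1 + - at_preimage d (x + 1) (- 1)"
      using balanced_diffD[OF assms, of x] by simp
  qed
qed

text \<open>Compactness of the circle \<open>\<real> \<union> {\<infinity>}\<close> for a function that vanishes at \<open>\<infinity>\<close>.\<close>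

lemma attains_positive_sup:
  fixes d :: "real \<Rightarrow> real"
  assumes cont: "continuous_on UNIV d" and top: "(d \<longlongrightarrow> 0) at_top" and bot: "(d \<longlongrightarrow> 0) at_bot"
    and pos: "0 < d x1"
  obtains x0 where "\<And>x. d x \<le> d x0" "0 < d x0"
proof -
  obtain b where b: "\<And>x. b \<le> x \<Longrightarrow> d x < d x1"
    using order_tendstoD(2)[OF top pos] by (auto simp: eventually_at_top_linorder)
  obtain a where a: "\<And>x. x \<le> a \<Longrightarrow> d x < d x1"
    using order_tendstoD(2)[OF bot pos] by (auto simp: eventually_at_bot_linorder)
  have x1: "x1 \<in> {a..b}" using a[of x1] b[of x1] by force
  obtain x0 where x0: "x0 \<in> {a..b}" "\<And>x. x \<in> {a..b} \<Longrightarrow> d x \<le> d x0"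
    using continuous_attains_sup[of "{a..b}" d] x1 continuous_on_subset[OF cont] by (metis compact_Icc empty_iff subset_UNIV)
  have "d x \<le> d x0" for x
    using x0(2)[of x] x0(2)[OF x1] a[of x] b[of x] by fastforce
  then show thesis using that[of x0] pos order_less_le_trans by blast
qed

lemma at_preimage_le: "(\<And>x. d x \<le> m) \<Longrightarrow> 0 \<le> m \<Longrightarrow> at_preimage d t a \<le> m"
  by (simp add: at_preimage_def)

text \<open>At a point with maximal value \<open>m > 0\<close> the nine summands on the right are at most \<open>m\<close>, which leaves
  no room for a positive constant next to \<open>9 * m\<close>.  If \<open>d\<close> has no positive
  value, the constant is a sum of nonpositive values.\<close>

lemma balanced_diff_constant_nonpos:
  assumes bal: "balanced_diff d"
    and cont: "continuous_on UNIV d" and top: "(d \<longlongrightarrow> 0) at_top" and bot: "(d \<longlongrightarrow> 0) at_bot"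
  shows "3 * d 0 + 2 * d 1 + 2 * d (- 1) \<le> 0"
proof (cases "\<exists>x1. 0 < d x1")
  case True
  then obtain x0 where x0: "\<And>x. d x \<le> d x0" "0 < d x0" using attains_positive_sup[OF cont top bot] by metis
  note le = at_preimage_le[of d "d x0", OF x0(1) less_imp_le[OF x0(2)]]
  show ?thesis
    using balanced_diffD[OF bal, of x0] x0(1)[of "x0 + 1"] x0(1)[of "x0 - 1"]
      le[of x0 0] le[of "x0 - 1" 0] le[of "x0 + 1" 0] le[of x0 1] le[of x0 "- 1"] le[of "x0 - 1" 1] le[of "x0 + 1" "- 1"]
    by linarith
next
  case False
  then have "d 0 \<le> 0" "d 1 \<le> 0" "d (- 1) \<le> 0" by (auto simp: not_less)
  then show ?thesis by simp
qed

text \<open>The maximum principle.  A positive maximum would be the average of nine values none of which exceeds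
  it, so it would spread from \<open>y\<close> to \<open>y + 1\<close> and hence along a sequence tending to infinity.\<close>

lemma balanced_diff_nonpos:
  assumes bal: "balanced_diff d" and K: "3 * d 0 + 2 * d 1 + 2 * d (- 1) = 0"
    and cont: "continuous_on UNIV d" and top: "(d \<longlongrightarrow> 0) at_top" and bot: "(d \<longlongrightarrow> 0) at_bot"
  shows "d x \<le> 0"
proof (rule ccontr)
  assume "\<not> d x \<le> 0"
  then obtain x0 where x0: "\<And>x. d x \<le> d x0" "0 < d x0" using attains_positive_sup[OF cont top bot, of x] by auto
  note le = at_preimage_le[of d "d x0", OF x0(1) less_imp_le[OF x0(2)]]
  have step: "d (y + 1) = d x0" if "d y = d x0" for y
    using balanced_diffD[OF bal, of y] K that x0(1)[of "y + 1"] x0(1)[of "y - 1"]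
      le[of y 0] le[of "y - 1" 0] le[of "y + 1" 0] le[of y 1] le[of y "- 1"] le[of "y - 1" 1] le[of "y + 1" "- 1"]
    by linarith
  have orbit: "d (x0 + real n) = d x0" for n
  proof (induction n)
    case (Suc n)
    then show ?case using step[of "x0 + real n"] by (simp add: add_ac)
  qed simp
  have "filterlim (\<lambda>n. x0 + real n) at_top sequentially"
    by (intro filterlim_tendsto_add_at_top[OF tendsto_const] filterlim_real_sequentially)
  from filterlim_compose[OF top this] have "(\<lambda>n. d x0) \<longlonglongrightarrow> 0" by (simp add: orbit)
  then show False using x0(2) by (simp add: LIMSEQ_const_iff)
qed

text \<open>The maximum principle applies once the additive constant is known to vanish; its sign is controlled
  from both sides, by the maximum of \<open>\<phi> - \<psi>\<close> and by that of \<open>\<psi> - \<phi>\<close>.\<close>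

lemma balanced_unique:
  assumes bal: "balanced \<phi>" "balanced \<psi>"
    and cont: "continuous_on UNIV \<phi>" "continuous_on UNIV \<psi>"
    and top: "(\<phi> \<longlongrightarrow> 0) at_top" "(\<psi> \<longlongrightarrow> 0) at_top"
    and bot: "(\<phi> \<longlongrightarrow> 1) at_bot" "(\<psi> \<longlongrightarrow> 1) at_bot"
  shows "\<phi> = \<psi>"
proof
  fix x
  define d where "d x = \<phi> x - \<psi> x" for x
  define e where "e x = - d x" for x
  have d: "balanced_diff d" "continuous_on UNIV d" "(d \<longlongrightarrow> 0) at_top" "(d \<longlongrightarrow> 0) at_bot"
    unfolding d_def using balanced_diff_diff[OF bal] continuous_on_diff[OF cont] tendsto_diff[OF top] tendsto_diff[OF bot]
    by simp_all
  have e: "balanced_diff e" "continuous_on UNIV e" "(e \<longlongrightarrow> 0) at_top" "(e \<longlongrightarrow> 0) at_bot"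
    unfolding e_def using balanced_diff_uminus[OF d(1)] continuous_on_minus[OF d(2)]
      tendsto_minus[OF d(3)] tendsto_minus[OF d(4)] by simp_all
  have K: "3 * d 0 + 2 * d 1 + 2 * d (- 1) = 0"
    using balanced_diff_constant_nonpos[OF d] balanced_diff_constant_nonpos[OF e] by (simp add: e_def)
  then have "3 * e 0 + 2 * e 1 + 2 * e (- 1) = 0" by (simp add: e_def)
  then have "e x \<le> 0" using balanced_diff_nonpos[OF e(1) _ e(2-4)] by blast
  moreover have "d x \<le> 0" using balanced_diff_nonpos[OF d(1) K d(2-4)] .
  ultimately show "\<phi> x = \<psi> x" by (simp add: e_def d_def)
qed

section \<open>The symmetric tail built from the Denjoy-Minkowski function\<close>

text \<open>Equivalently, the law is invariant under reflection and has tail \<open>c / 2\<close> on \<open>[0, \<infinity>)\<close>.\<close>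

definition symmetric_tail :: "(real \<Rightarrow> real) \<Rightarrow> real \<Rightarrow> real" where
  "symmetric_tail c x = (if 0 \<le> x then c x / 2 else 1 - c (- x) / 2)"

lemma symmetric_tail_cdf_like:
  assumes zero: "c 0 = 1" and cont: "continuous_on {0..} c" and top: "(c \<longlongrightarrow> 0) at_top"
  shows "continuous_on UNIV (symmetric_tail c)" "(symmetric_tail c \<longlongrightarrow> 0) at_top"
    "(symmetric_tail c \<longlongrightarrow> 1) at_bot"
proof -
  have "continuous_on ({0..} \<union> {..0}) (\<lambda>x. if 0 \<le> x then c x / 2 else 1 - c (- x) / 2)"
  proof (rule continuous_on_cases)
    show "continuous_on {..0} (\<lambda>x. 1 - c (- x) / 2)"
      by (intro continuous_intros continuous_on_compose2[OF cont]) auto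
  qed (use zero in \<open>auto intro!: continuous_intros cont\<close>)
  moreover have "{0..} \<union> {..0} = (UNIV :: real set)" by auto
  ultimately show "continuous_on UNIV (symmetric_tail c)"
    by (simp add: symmetric_tail_def[abs_def])
  have "((\<lambda>x. c x / 2) \<longlongrightarrow> 0 / 2) at_top" by (intro tendsto_intros top) simp
  then show "(symmetric_tail c \<longlongrightarrow> 0) at_top"
    unfolding div_0 by (rule Lim_transform_eventually)
      (auto simp: symmetric_tail_def intro: eventually_mono[OF eventually_ge_at_top[of 0]])
  have "((\<lambda>x. 1 - c (- x) / 2) \<longlongrightarrow> 1 - 0 / 2) at_bot"
    by (intro tendsto_intros filterlim_compose[OF top filterlim_uminus_at_top_at_bot]) simp
  then show "(symmetric_tail c \<longlongrightarrow> 1) at_bot"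
    unfolding div_0 diff_0_right by (rule Lim_transform_eventually)
      (auto simp: symmetric_tail_def intro: eventually_mono[OF eventually_gt_at_bot[of 0]])
qed

text \<open>The equations for \<open>c\<close> say that the law \<open>\<nu>\<close> with tail function \<open>\<psi>\<close> is invariant under \<open>x \<mapsto> - x\<close>
  and under \<open>x \<mapsto> - 1 / x\<close>, and that \<open>\<nu> (x + 1, \<infinity>)\<close> is half of \<open>\<nu> (x, \<infinity>)\<close> for \<open>x \<ge> 0\<close>.  Reflection reduces the
  claim to \<open>x \<ge> 0\<close>.  There the summands are affine functions of \<open>\<psi> x\<close>; only the
  mass of the ray \<open>(x - 1, \<infinity>)\<close> and those of two arcs are given by different formulas for \<open>x < 1\<close> and for
  \<open>x > 1\<close>.\<close>

lemma balanced_symmetric_tail: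
  assumes zero: "c 0 = 1" and shift: "\<And>x. 0 \<le> x \<Longrightarrow> c (x + 1) = c x / 2"
    and inv: "\<And>x. 0 < x \<Longrightarrow> c (1 / x) = 1 - c x"
  shows "balanced (symmetric_tail c)"
proof -
  define \<psi> where "\<psi> = symmetric_tail c"
  note \<psi>_def = \<psi>_def symmetric_tail_def
  have neg: "\<psi> (- x) = 1 - \<psi> x" for x using zero by (auto simp: \<psi>_def)
  have sh: "\<psi> (x + 1) = \<psi> x / 2" if "0 \<le> x" for x using shift[OF that] that by (simp add: \<psi>_def)
  have iv: "\<psi> (1 / x) = 1 / 2 - \<psi> x" if "0 < x" for x using inv[OF that] that by (simp add: \<psi>_def diff_divide_distrib)
  have \<psi>0: "\<psi> 0 = 1 / 2" using zero by (simp add: \<psi>_def)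
  have \<psi>1: "\<psi> 1 = 1 / 4" using sh[of 0] \<psi>0 by simp
  have \<psi>m1: "\<psi> (- 1) = 3 / 4" using neg[of 1] \<psi>1 by simp
  define S where "S x = \<psi> (x - 1) + \<psi> (x + 1)
     + arc_mass \<psi> x 0 + arc_mass \<psi> (x - 1) 0 + arc_mass \<psi> (x + 1) 0
     + arc_mass \<psi> x 1 + arc_mass \<psi> x (- 1)
     + arc_mass \<psi> (x - 1) 1 + arc_mass \<psi> (x + 1) (- 1)" for x
  have arc_neg: "arc_mass \<psi> (- t) (- a) = 1 - arc_mass \<psi> t a" for t a
    using neg[of "- 1 / t - a"] neg[of a] by (auto simp: arc_mass_def algebra_simps)
  \<comment> \<open>Reflection maps the nine arcs for \<open>x\<close> to the complements of those for \<open>- x\<close>.\<close>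
  have S_neg: "S (- x) = 9 - S x" for x
    using arc_neg[of x 0] arc_neg[of "x - 1" 0] arc_neg[of "x + 1" 0] arc_neg[of x 1] arc_neg[of x "- 1"]
      arc_neg[of "x - 1" 1] arc_neg[of "x + 1" "- 1"] neg[of "x - 1"] neg[of "x + 1"]
    by (simp add: S_def)
  have arc0_pos: "arc_mass \<psi> t 0 = \<psi> t" if "0 < t" for t
    using iv[OF that] neg[of "1 / t"] that by (simp add: arc_mass_def \<psi>0)
  have arc0: "arc_mass \<psi> t 0 = \<psi> t" for t
  proof -
    consider "0 < t" | "t = 0" | "0 < - t" by linarith
    then show ?thesis
    proof cases
      case 3
      then show ?thesis using arc0_pos[OF 3] arc_neg[of "- t" 0] neg[of t] by simp
    qed (auto simp: arc0_pos, simp add: arc_mass_def \<psi>0)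
  qed
  have pos: "S x = 9 * \<psi> x" if x: "0 < x" for x
  proof -
    have iv1: "\<psi> (1 + 1 / x) = 1 / 4 - \<psi> x / 2" using sh[of "1 / x"] iv[OF x] x by (simp add: add.commute)
    have A1: "arc_mass \<psi> x 1 = \<psi> x / 2"
    proof -
      have "- 1 / x - 1 = - (1 + 1 / x)" by simp
      then have "\<psi> (- 1 / x - 1) = 3 / 4 + \<psi> x / 2" using iv1 neg[of "1 + 1 / x"] by (simp only:)
      then show ?thesis using x unfolding arc_mass_def \<psi>m1 by (simp only:) simp
    qed
    have A2: "arc_mass \<psi> (x + 1) (- 1) = \<psi> x / 2"
    proof -
      have "1 - 1 / (x + 1) = 1 / (1 + 1 / x)" using x by (simp add: field_simps)
      then have "\<psi> (1 - 1 / (x + 1)) = 1 / 4 + \<psi> x / 2" using iv[of "1 + 1 / x"] iv1 x by (simp add: add_pos_pos)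
      then show ?thesis using x by (simp add: arc_mass_def \<psi>1)
    qed
    have S1: "S x = \<psi> (x - 1) + \<psi> x / 2 + \<psi> x + \<psi> (x - 1) + \<psi> x / 2 + \<psi> x / 2 + arc_mass \<psi> x (- 1)
       + arc_mass \<psi> (x - 1) 1 + \<psi> x / 2"
      unfolding S_def arc0 A1 A2 using sh[of x] x by simp
    consider "1 < x" | "x = 1" | "x < 1" by linarith
    then show ?thesis
    proof cases
      case 1
      then have u: "0 < x - 1" by simp
      have m: "\<psi> (x - 1) = 2 * \<psi> x" using sh[of "x - 1"] u by simp
      have n: "\<psi> (1 + 1 / (x - 1)) = 1 / 4 - \<psi> x" using sh[of "1 / (x - 1)"] iv[OF u] u m by (simp add: add.commute)
      have "1 - 1 / x = 1 / (1 + 1 / (x - 1))" using 1 by (simp add: field_simps)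
      then have "\<psi> (1 - 1 / x) = 1 / 4 + \<psi> x" using iv[of "1 + 1 / (x - 1)"] n u by (simp add: add_pos_pos)
      then have B1: "arc_mass \<psi> x (- 1) = \<psi> x" using x by (simp add: arc_mass_def \<psi>1)
      have "arc_mass \<psi> (x - 1) 1 = \<psi> x"
      proof -
        have "- 1 / (x - 1) - 1 = - (1 + 1 / (x - 1))" by simp
        then have "\<psi> (- 1 / (x - 1) - 1) = 3 / 4 + \<psi> x" using n neg[of "1 + 1 / (x - 1)"] by (simp only:)
        then show ?thesis using u unfolding arc_mass_def \<psi>m1 by (simp only:) simp
      qed
      then show ?thesis using S1 B1 m by simp
    next
      case 2
      then show ?thesis using S1 by (simp add: arc_mass_def \<psi>0 \<psi>1 \<psi>m1)
    next
      case 3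
      then have u: "0 < 1 / x - 1" using x by simp
      have m: "\<psi> (1 / x - 1) = 1 - 2 * \<psi> x" using sh[of "1 / x - 1"] iv[OF x] u by simp
      have q: "x / (1 - x) = 1 / (1 / x - 1)" using 3 x by (simp add: field_simps)
      have n: "\<psi> (x / (1 - x)) = 2 * \<psi> x - 1 / 2" unfolding q using iv[OF u] m by simp
      have B1: "arc_mass \<psi> x (- 1) = 2 * \<psi> x - 1 / 4"
      proof -
        have "- 1 / x + 1 = - (1 / x - 1)" by simp
        then have "\<psi> (- 1 / x - - 1) = 2 * \<psi> x" using neg[of "1 / x - 1"] m by simp
        then show ?thesis using x unfolding arc_mass_def by (simp add: \<psi>1)
      qed
      have "- 1 / (x - 1) - 1 = x / (1 - x)" using 3 by (simp add: field_simps)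
      then have B2: "arc_mass \<psi> (x - 1) 1 = 2 * \<psi> x - 1 / 4"
        using n 3 by (simp add: arc_mass_def \<psi>m1)
      have "1 - x = 1 / (x / (1 - x) + 1)" using 3 by (simp add: field_simps)
      then have "\<psi> (1 - x) = 3 / 4 - \<psi> x"
        using iv[of "x / (1 - x) + 1"] sh[of "x / (1 - x)"] n x 3 by (simp add: add_nonneg_pos diff_divide_distrib)
      then have "\<psi> (x - 1) = 1 / 4 + \<psi> x" using neg[of "1 - x"] by simp
      then show ?thesis using S1 B1 B2 by simp
    qed
  qed
  have "9 * \<psi> x = S x" for x
  proof -
    consider "0 < x" | "x = 0" | "0 < - x" by linarith
    then show ?thesis
    proof cases
      case 2
      then show ?thesis using S_neg[of 0] \<psi>0 by simp
    next
      case 3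
      then show ?thesis using pos[OF 3] S_neg[of x] neg[of x] by simp
    qed (simp add: pos)
  qed
  then have "balanced \<psi>" unfolding balanced_def S_def by blast
  then show ?thesis by (simp add: \<psi>_def(1))
qed

section \<open>Measurability on the extended line\<close>

lemma space_borel_RP1: "space borel_RP1 = UNIV"
proof -
  have "topspace RP1 = UNIV"
    by (simp add: RP1_def UNIV_option_conv)
  then show ?thesis by (simp add: borel_RP1_def space_measure_of_conv)
qed

lemma sets_borel_RP1: "sets borel_RP1 = sigma_sets (topspace RP1) {U. openin RP1 U}"
  unfolding borel_RP1_def by (rule sets_measure_of) (auto dest: openin_subset)

lemma openin_in_sets_borel_RP1: "openin RP1 U \<Longrightarrow> U \<in> sets borel_RP1"
  unfolding sets_borel_RP1 by (rule sigma_sets.Basic) simp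

lemma Some_image_in_sets:
  assumes "B \<in> sets (borel :: real measure)" shows "Some ` B \<in> sets borel_RP1"
proof -
  have open_Some: "Some ` U \<in> sets borel_RP1" if "open U" for U :: "real set"
    using openin_in_sets_borel_RP1[of "Some ` U"] that by (simp add: RP1_def)
  have "B \<in> sigma_sets UNIV {S. open S}" using assms by (simp add: borel_def)
  then show ?thesis
  proof induction
    case (Compl B)
    have "Some ` (UNIV - B) = Some ` UNIV - Some ` B" by auto
    then show ?case using Compl.IH open_Some[of UNIV] by auto
  next
    case (Union B)
    then show ?case by (auto simp: image_UN)
  qed (use open_Some in auto)
qed

lemma Some_measurable_borel_RP1: "Some \<in> (borel :: real measure) \<rightarrow>\<^sub>M borel_RP1"
  unfolding borel_RP1_def
proof (rule measurable_sigma_sets[OF sets_measure_of])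
  show "{U. openin RP1 U} \<subseteq> Pow (topspace RP1)" by (auto dest: openin_subset)
  then show "{U. openin RP1 U} \<subseteq> Pow (topspace RP1)" .
  show "Some \<in> space (borel :: real measure) \<rightarrow> topspace RP1" by (auto simp: RP1_def)
next
  fix U assume "U \<in> {U. openin RP1 U}"
  then have "openin euclideanreal {x \<in> topspace euclideanreal. Some x \<in> U}"
    unfolding RP1_def using continuous_map_Some[of euclideanreal] by (auto simp: continuous_map_def)
  then show "Some -` U \<inter> space (borel :: real measure) \<in> sets borel"
    by (simp add: vimage_def)
qed

text \<open>The point at infinity is closed, so measurability in \<open>\<real> \<union> {\<infinity>}\<close> is decided on the real part.\<close>

lemma in_sets_borel_RP1I:
  assumes "Some -` A \<in> sets (borel :: real measure)" shows "A \<in> sets borel_RP1"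
proof -
  have None: "{None} \<in> sets borel_RP1"
  proof -
    have "{None} = space borel_RP1 - Some ` (UNIV :: real set)"
      by (auto simp: space_borel_RP1 UNIV_option_conv)
    then show ?thesis using Some_image_in_sets[of UNIV] by auto
  qed
  have "A = Some ` (Some -` A) \<union> (A \<inter> {None})"
    using option.exhaust by (auto simp: image_iff)
  moreover have "A \<inter> {None} \<in> sets borel_RP1" using None by (cases "None \<in> A") auto
  ultimately show ?thesis using Some_image_in_sets[OF assms] by (metis sets.Un)
qed

lemma singleton_in_sets_borel_RP1: "{z} \<in> sets borel_RP1"
  by (rule in_sets_borel_RP1I, cases z) (auto simp: vimage_def)

lemma the_measurable_borel_RP1: "case_option 0 (\<lambda>r. r) \<in> borel_RP1 \<rightarrow>\<^sub>M (borel :: real measure)"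
  by (rule measurableI) (auto simp: space_borel_RP1 vimage_def intro!: in_sets_borel_RP1I)

section \<open>Stationary laws have no atoms\<close>

text \<open>The nine matrices are distinct, so each has probability \<open>1 / 9\<close>.\<close>

lemma emeasure_step:
  assumes M: "iid_uniform_E P M"
  shows "emeasure P {\<omega> \<in> space P. chain M x 1 \<omega> \<in> A}
    = (\<Sum>i\<le>8. ennreal (1 / 9) * indicator {y. moebius (E i) y \<in> A} x)"
proof -
  let ?C = "count_space (E ` {..8})"
  interpret prob_space P using M by (simp add: iid_uniform_E_def)
  have meas: "M 1 \<in> P \<rightarrow>\<^sub>M ?C"
    using M unfolding iid_uniform_E_def indep_vars_def by simp
  have law: "distr P ?C (M 1) = uniform_count_measure (E ` {..8})"
    using M by (simp add: iid_uniform_E_def)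
  have inj: "inj_on E {..8}" using inj_on_E by (auto intro: inj_onI)
  then have card: "card (E ` {..8}) = 9" by (simp add: card_image)
  have "{\<omega> \<in> space P. chain M x 1 \<omega> \<in> A} = M 1 -` {e \<in> E ` {..8}. moebius e x \<in> A} \<inter> space P"
    using measurable_space[OF meas] by auto
  then have "emeasure P {\<omega> \<in> space P. chain M x 1 \<omega> \<in> A}
      = emeasure (distr P ?C (M 1)) {e \<in> E ` {..8}. moebius e x \<in> A}"
    using meas by (simp add: emeasure_distr)
  also have "\<dots> = ennreal (card {e \<in> E ` {..8}. moebius e x \<in> A} / 9)"
    unfolding law by (subst emeasure_uniform_count_measure) (auto simp: card)
  also have "card {e \<in> E ` {..8}. moebius e x \<in> A} = card {i \<in> {..8}. moebius (E i) x \<in> A}"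
  proof -
    have "{e \<in> E ` {..8}. moebius e x \<in> A} = E ` {i \<in> {..8}. moebius (E i) x \<in> A}" by auto
    then show ?thesis using inj by (metis (no_types, lifting) card_image inj_on_subset mem_Collect_eq subsetI)
  qed
  also have "ennreal (card {i \<in> {..8}. moebius (E i) x \<in> A} / 9)
      = of_nat (card {i \<in> {..8}. moebius (E i) x \<in> A}) * ennreal (1 / 9)"
    by (simp add: ennreal_of_nat_eq_real_of_nat flip: ennreal_mult')
  also have "\<dots> = (\<Sum>i\<le>8. ennreal (1 / 9) * indicator {y. moebius (E i) y \<in> A} x)"
    by simp
  finally show ?thesis .
qed

lemma moebius_measurable: "moebius e \<in> borel_RP1 \<rightarrow>\<^sub>M borel_RP1"
proof (rule measurableI)
  fix A assume A: "A \<in> sets borel_RP1"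
  have B: "Some -` A \<in> sets borel" using measurable_sets[OF Some_measurable_borel_RP1 A] by simp
  note [measurable] = B
  have "Some -` (moebius e -` A \<inter> space borel_RP1)
      = {x. (e$2$1 * x + e$2$2 = 0 \<and> None \<in> A)
          \<or> (e$2$1 * x + e$2$2 \<noteq> 0 \<and> (e$1$1 * x + e$1$2) / (e$2$1 * x + e$2$2) \<in> Some -` A)}"
    by (auto simp: space_borel_RP1 moebius_def split: if_splits)
  also have "\<dots> \<in> sets borel" by measurable
  finally show "moebius e -` A \<inter> space borel_RP1 \<in> sets borel_RP1" by (rule in_sets_borel_RP1I)
qed (simp add: space_borel_RP1)

lemma inj_moebius_E:
  assumes "i \<le> 8" "moebius (E i) z = moebius (E i) w" shows "z = w"
proof -
  have "i = 0 \<or> i = 1 \<or> i = 2 \<or> i = 3 \<or> i = 4 \<or> i = 5 \<or> i = 6 \<or> i = 7 \<or> i = 8"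
    using assms(1) by linarith
  then show ?thesis using assms(2)
    by (elim disjE; cases z; cases w)
      (simp_all add: moebius_E_Some moebius_E_None field_simps del: One_nat_def split: if_splits)
qed

lemma stationary_measure_eq:
  assumes M: "iid_uniform_E P M" and st: "stationary P M L" and A: "A \<in> sets borel_RP1"
  shows "measure L A = (\<Sum>i\<le>8. measure L {y. moebius (E i) y \<in> A}) / 9"
proof -
  interpret L: prob_space L using st by (simp add: stationary_def)
  have sets: "sets L = sets borel_RP1" using st by (simp add: stationary_def)
  have pre: "{y. moebius (E i) y \<in> A} \<in> sets L" for i
    using measurable_sets[OF moebius_measurable A] unfolding sets by (simp add: space_borel_RP1 vimage_def)
  have "emeasure L A = (\<integral>\<^sup>+ x. (\<Sum>i\<le>8. ennreal (1 / 9) * indicator {y. moebius (E i) y \<in> A} x) \<partial>L)"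
    using st A unfolding stationary_def emeasure_step[OF M] by blast
  also have "\<dots> = (\<Sum>i\<le>8. ennreal (1 / 9) * emeasure L {y. moebius (E i) y \<in> A})"
    by (subst nn_integral_sum) (use pre in \<open>auto simp: nn_integral_cmult_indicator\<close>)
  also have "\<dots> = ennreal (\<Sum>i\<le>8. 1 / 9 * measure L {y. moebius (E i) y \<in> A})"
    by (simp add: L.emeasure_eq_measure flip: ennreal_mult')
  finally show ?thesis
    unfolding L.emeasure_eq_measure by (subst (asm) ennreal_inj) (auto intro: sum_nonneg simp: sum_divide_distrib)
qed

lemma sum_atMost_8: "(\<Sum>i\<le>8. g i) = g 0 + g 1 + g 2 + g 3 + g 4 + g 5 + g 6 + g 7 + g (8::nat)"
  for g :: "nat \<Rightarrow> real"
  by (simp add: numeral_eq_Suc)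

lemma (in prob_space) point_masses_tendsto_0:
  assumes inj: "inj f" and meas: "\<And>z. {z} \<in> sets M"
  shows "(\<lambda>n. measure M {f (n::nat)}) \<longlonglongrightarrow> 0"
proof -
  have "(\<lambda>n. measure M {f n}) sums measure M (\<Union>n. {f n})"
    by (rule finite_measure_UNION) (use inj meas in \<open>auto simp: disjoint_family_on_def inj_eq\<close>)
  then show ?thesis using summable_LIMSEQ_zero sums_summable by blast
qed

text \<open>Only finitely many points carry at least the mass of a given atom, so some atom \<open>z0\<close> has maximal mass.
  By stationarity this mass is the average of the masses of the nine preimages of \<open>z0\<close>, hence
  shared by all of them.  Moving from \<open>\<infinity>\<close> to its preimage \<open>0\<close> under \<open>x \<mapsto> - 1 / x\<close> if necessary and then
  along the preimages under \<open>x \<mapsto> x - 1\<close> gives infinitely many atoms of equal mass.\<close>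

lemma stationary_point_mass_eq_0:
  assumes M: "iid_uniform_E P M" and st: "stationary P M L"
  shows "measure L {z} = 0"
proof (rule ccontr)
  assume nz: "measure L {z} \<noteq> 0"
  interpret L: prob_space L using st by (simp add: stationary_def)
  have meas: "{z} \<in> sets L" for z using singleton_in_sets_borel_RP1 st by (simp add: stationary_def)
  define p where "p z = measure L {z}" for z
  have "finite {y. p z \<le> p y}"
  proof (rule ccontr)
    assume "infinite {y. p z \<le> p y}"
    then obtain f :: "nat \<Rightarrow> _" where f: "inj f" "range f \<subseteq> {y. p z \<le> p y}"
      using infinite_countable_subset by blast
    have "p z \<le> 0"
      by (rule tendsto_lowerbound[OF L.point_masses_tendsto_0[OF f(1) meas]]) (use f(2) in \<open>auto simp: p_def intro!: always_eventually\<close>)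
    then show False using nz measure_nonneg[of L "{z}"] by (simp add: p_def)
  qed
  then have fin: "finite (p ` {y. p z \<le> p y})" by simp
  then have "Max (p ` {y. p z \<le> p y}) \<in> p ` {y. p z \<le> p y}" by (rule Max_in) auto
  then obtain z0 where z0: "p z \<le> p z0" "p z0 = Max (p ` {y. p z \<le> p y})" by auto
  have mx: "p y \<le> p z0" for y
    using Max_ge[OF fin, of "p y"] z0 by (cases "p z \<le> p y") auto
  have pos: "0 < p z0" using z0(1) nz measure_nonneg[of L "{z}"] unfolding p_def by linarith
  have eq: "9 * p y = (\<Sum>i\<le>8. measure L {w. moebius (E i) w = y})" for y
    using stationary_measure_eq[OF M st singleton_in_sets_borel_RP1, of y] by (simp add: p_def)
  have preimage: "{w. moebius (E i) w = y} = {v}" if "moebius (E i) v = y" "i \<le> 8" for i y v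
  proof (intro equalityI subsetI)
    fix w assume "w \<in> {w. moebius (E i) w = y}"
    then have "moebius (E i) w = moebius (E i) v" using that(1) by simp
    from inj_moebius_E[OF that(2) this] show "w \<in> {v}" by simp
  qed (use that(1) in simp)
  have le: "measure L {w. moebius (E i) w = y} \<le> p z0" if "i \<le> 8" for i y
  proof (cases "\<exists>w. moebius (E i) w = y")
    case True
    then obtain w where "moebius (E i) w = y" by blast
    from preimage[OF this that] show ?thesis using mx[of w] by (simp add: p_def)
  next
    case False
    then have "{w. moebius (E i) w = y} = {}" by auto
    then show ?thesis using pos by simp
  qed
  have inherit: "p v = p z0" if y: "p y = p z0" and v: "moebius (E i) v = y" and i: "i \<le> 8" for i y v
  proof (rule ccontr)
    assume "p v \<noteq> p z0"
    then have "measure L {w. moebius (E i) w = y} < p z0"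
      using mx[of v] unfolding preimage[OF v i] p_def by linarith
    then have "(\<Sum>i\<le>8. measure L {w. moebius (E i) w = y}) < (\<Sum>i\<le>8::nat. p z0)"
      using i le by (intro sum_strict_mono_ex1) auto
    then show False using eq[of y] y by simp
  qed
  obtain x where x: "p (Some x) = p z0"
  proof (cases z0)
    case None
    have "moebius (E 0) (Some 0) = z0" by (simp add: moebius_E_Some None)
    from inherit[OF refl this] that show thesis by simp
  qed (use that in auto)
  have orbit: "p (Some (x + real n)) = p z0" for n
  proof (induction n)
    case (Suc n)
    have "moebius (E 2) (Some (x + real (Suc n))) = Some (x + real n)" by (simp add: moebius_E_Some)
    from inherit[OF Suc this] show ?case by simp
  qed (simp add: x)
  have "(\<lambda>n. p (Some (x + real n))) \<longlonglongrightarrow> 0"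
    unfolding p_def by (rule L.point_masses_tendsto_0[OF _ meas]) (simp add: inj_def)
  then show False using pos by (simp add: orbit LIMSEQ_const_iff)
qed

section \<open>Tail functions of atomless distributions\<close>

definition tail :: "real measure \<Rightarrow> real \<Rightarrow> real" where
  "tail N x = measure N {x<..}"

locale atomless_distribution = real_distribution N for N :: "real measure" +
  assumes atomless: "measure N {x} = 0"
begin

lemma tail_eq_cdf: "tail N x = 1 - cdf N x"
proof -
  have "{x<..} = space N - {..x}" by auto
  then show ?thesis unfolding tail_def cdf_def by (metis prob_compl atMost_borel events_eq_borel)
qed

lemma measure_lessThan: "measure N {..<x} = 1 - tail N x"
proof -
  have "measure N {..x} = measure N {..<x} + measure N {x}"
    by (subst finite_measure_Union[symmetric]) (auto intro!: arg_cong[where f = "measure N"])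
  then show ?thesis using atomless[of x] by (simp add: tail_eq_cdf cdf_def)
qed

lemma measure_greaterThanLessThan:
  assumes "a \<le> b" shows "measure N {a<..<b} = tail N a - tail N b"
proof -
  have "measure N {a<..} = measure N ({a<..<b} \<union> {b} \<union> {b<..})" if "a < b"
    by (rule arg_cong[where f = "measure N"]) (use that in auto)
  moreover have "\<dots> = measure N {a<..<b} + measure N {b} + measure N {b<..}"
    by (subst finite_measure_Union; (subst finite_measure_Union)?) auto
  ultimately show ?thesis using atomless[of b] assms by (cases "a = b") (auto simp: tail_def)
qed

lemma continuous_tail: "continuous_on UNIV (tail N)"
  unfolding continuous_on_eq_continuous_at[OF open_UNIV] tail_eq_cdf[abs_def]
  using isCont_cdf atomless by (auto intro!: continuous_intros)

lemma tail_at_top: "(tail N \<longlongrightarrow> 0) at_top"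
  using tendsto_diff[OF tendsto_const[of 1] cdf_lim_at_top_prob] by (simp add: tail_eq_cdf[abs_def])

lemma tail_at_bot: "(tail N \<longlongrightarrow> 1) at_bot"
  using tendsto_diff[OF tendsto_const[of 1] cdf_lim_at_bot] by (simp add: tail_eq_cdf[abs_def])

lemma measure_inverted_ray: "measure N {r. r + a \<noteq> 0 \<and> t < - 1 / (r + a)} = arc_mass (tail N) t a"
proof -
  consider "0 < t" | "t = 0" | "t < 0" by linarith
  then show ?thesis
  proof cases
    case 1
    have "t < - 1 / y \<longleftrightarrow> - 1 / t < y \<and> y < 0" if "y \<noteq> 0" for y
    proof (cases "0 < y")
      case True
      then have "- 1 / y < 0" by simp
      then have "\<not> t < - 1 / y" using 1 by linarith
      with True show ?thesis by simp
    next
      case False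
      with 1 that show ?thesis by (auto simp: field_simps)
    qed
    from this[of "r + a" for r] have "{r. r + a \<noteq> 0 \<and> t < - 1 / (r + a)} = {- 1 / t - a <..< - a}"
      by (auto simp: algebra_simps)
    then show ?thesis using measure_greaterThanLessThan[of "- 1 / t - a" "- a"] 1 by (simp add: arc_mass_def)
  next
    case 2
    have "t < - 1 / y \<longleftrightarrow> y < 0" if "y \<noteq> 0" for y
      using 2 that by (auto simp: field_simps zero_less_divide_iff)
    from this[of "r + a" for r] have "{r. r + a \<noteq> 0 \<and> t < - 1 / (r + a)} = {..< - a}"
      by (auto simp: algebra_simps)
    then show ?thesis using measure_lessThan[of "- a"] 2 by (simp add: arc_mass_def)
  next
    case 3
    have "t < - 1 / y \<longleftrightarrow> y < 0 \<or> - 1 / t < y" if "y \<noteq> 0" for y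
    proof (cases "0 < y")
      case True
      with 3 show ?thesis by (auto simp: field_simps)
    next
      case False
      with that have "y < 0" by simp
      then have "0 < - 1 / y" by simp
      with 3 have "t < - 1 / y" by linarith
      with \<open>y < 0\<close> show ?thesis by simp
    qed
    note iff = this
    have "0 < - 1 / t" using 3 by simp
    then have "r + a \<noteq> 0 \<and> t < - 1 / (r + a) \<longleftrightarrow> r < - a \<or> - 1 / t - a < r" for r
    proof (cases "r + a = 0")
      case True
      with \<open>0 < - 1 / t\<close> have "\<not> r < - a" "\<not> - 1 / t - a < r" by linarith+
      with True show ?thesis by blast
    next
      case False
      have "r + a < 0 \<longleftrightarrow> r < - a" "- 1 / t < r + a \<longleftrightarrow> - 1 / t - a < r" by linarith+
      with iff[OF False] False show ?thesis by blast
    qed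
    then have "{r. r + a \<noteq> 0 \<and> t < - 1 / (r + a)} = {..< - a} \<union> {- 1 / t - a <..}"
      by (intro set_eqI) (simp only: mem_Collect_eq Un_iff lessThan_iff greaterThan_iff)
    moreover have "{..< - a} \<inter> {- 1 / t - a <..} = {}"
    proof -
      have "\<not> (r < - a \<and> - 1 / t - a < r)" for r using \<open>0 < - 1 / t\<close> by linarith
      then show ?thesis unfolding disjoint_iff lessThan_iff greaterThan_iff by blast
    qed
    ultimately have "measure N {r. r + a \<noteq> 0 \<and> t < - 1 / (r + a)} = measure N {..< - a} + measure N {- 1 / t - a <..}"
      by (simp add: finite_measure_Union)
    then show ?thesis using measure_lessThan[of "- a"] 3 by (simp add: arc_mass_def tail_def)
  qed
qed

end

section \<open>The tail of a stationary law\<close>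

text \<open>The default value \<open>0\<close> at \<open>\<infinity>\<close> is immaterial for laws without mass there (see \<open>measure_real_part\<close>); the
  point of the definition is to have a distribution on the real line with a distribution function.\<close>

definition real_part :: "real option measure \<Rightarrow> real measure" where
  "real_part L = distr L borel (case_option 0 (\<lambda>r. r))"

lemma measure_real_part:
  fixes A :: "real option set"
  assumes L: "finite_measure L" "sets L = sets borel_RP1" and None: "measure L {None} = 0"
    and A: "Some -` A \<in> sets borel"
  shows "measure (real_part L) (Some -` A) = measure L A"
proof -
  interpret finite_measure L by fact
  have space: "space L = UNIV" using sets_eq_imp_space_eq[OF L(2)] by (simp add: space_borel_RP1)
  have meas: "case_option 0 (\<lambda>r. r) \<in> L \<rightarrow>\<^sub>M (borel :: real measure)"
    using the_measurable_borel_RP1 by (simp add: measurable_cong_sets[OF L(2) refl])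
  let ?B = "case_option 0 (\<lambda>r. r) -` (Some -` A)"
  have B: "?B \<in> sets L" "A \<in> sets L"
    using measurable_sets[OF meas A] in_sets_borel_RP1I[OF A] by (simp_all add: space L(2))
  have null: "emeasure L {None} = 0" using None by (simp add: emeasure_eq_measure)
  have "measure L ?B = measure L A"
  proof (rule measure_eq_AE)
    have "AE z in L. z \<noteq> None"
      by (rule AE_I[of _ _ "{None}"]) (use null singleton_in_sets_borel_RP1 in \<open>auto simp: L(2)\<close>)
    then show "AE z in L. z \<in> ?B \<longleftrightarrow> z \<in> A" by eventually_elim (auto split: option.splits)
  qed (use B in auto)
  then show ?thesis unfolding real_part_def using meas A by (simp add: measure_distr space)
qed

lemma stationary_atomless:
  assumes M: "iid_uniform_E P M" and st: "stationary P M L"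
  shows "atomless_distribution (real_part L)"
proof -
  interpret L: prob_space L using st by (simp add: stationary_def)
  have sets: "sets L = sets borel_RP1" using st by (simp add: stationary_def)
  have meas: "case_option 0 (\<lambda>r. r) \<in> L \<rightarrow>\<^sub>M (borel :: real measure)"
    using the_measurable_borel_RP1 by (simp add: measurable_cong_sets[OF sets refl])
  interpret N: real_distribution "real_part L"
    unfolding real_part_def using L.real_distribution_distr[OF meas] .
  have "measure (real_part L) {x} = 0" for x
    using measure_real_part[of L "{Some x}"] L.finite_measure_axioms sets stationary_point_mass_eq_0[OF M st]
    by (simp add: vimage_def)
  then show ?thesis by unfold_locales
qed

lemma balanced_tail:
  assumes M: "iid_uniform_E P M" and st: "stationary P M L"
  shows "balanced (tail (real_part L))"
  unfolding balanced_def
proof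
  fix x :: real
  let ?N = "real_part L" and ?\<phi> = "tail (real_part L)"
  interpret L: prob_space L using st by (simp add: stationary_def)
  interpret N: atomless_distribution ?N by (rule stationary_atomless[OF M st])
  have sets: "sets L = sets borel_RP1" using st by (simp add: stationary_def)
  let ?A = "Some ` {x<..}"
  have A: "?A \<in> sets borel_RP1" by (rule Some_image_in_sets) simp
  have m: "measure L {y. moebius (E i) y \<in> ?A} = measure ?N {r. moebius (E i) (Some r) \<in> ?A}" for i
  proof -
    have "{y. moebius (E i) y \<in> ?A} \<in> sets borel_RP1"
      using measurable_sets[OF moebius_measurable A] by (simp add: space_borel_RP1 vimage_def)
    from measurable_sets[OF Some_measurable_borel_RP1 this]
    have "Some -` {y. moebius (E i) y \<in> ?A} \<in> sets borel" by simp
    from measure_real_part[OF L.finite_measure_axioms sets stationary_point_mass_eq_0[OF M st] this]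
    show ?thesis by (simp add: vimage_def)
  qed
  have inv: "measure ?N {r. moebius (E i) (Some r) \<in> ?A} = arc_mass ?\<phi> t a"
    if "\<And>r. moebius (E i) (Some r) = (if r + a = 0 then None else Some (- 1 / (r + a) + (x - t)))" for i t a
  proof -
    have "{r. moebius (E i) (Some r) \<in> ?A} = {r. r + a \<noteq> 0 \<and> t < - 1 / (r + a)}"
      by (auto simp: that)
    then show ?thesis by (simp only: N.measure_inverted_ray)
  qed
  have shift: "measure ?N {r. moebius (E i) (Some r) \<in> ?A} = ?\<phi> (x - s)"
    if "\<And>r. moebius (E i) (Some r) = Some (r + s)" for i s
    unfolding tail_def by (rule arg_cong[where f = "measure ?N"]) (auto simp: that)
  have e0: "measure ?N {r. moebius (E 0) (Some r) \<in> ?A} = arc_mass ?\<phi> x 0"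
    by (rule inv) (simp add: moebius_E_Some)
  have e1: "measure ?N {r. moebius (E 1) (Some r) \<in> ?A} = ?\<phi> (x - 1)"
    by (rule shift) (simp add: moebius_E_Some del: One_nat_def)
  have e2: "measure ?N {r. moebius (E 2) (Some r) \<in> ?A} = ?\<phi> (x - (- 1))"
    by (rule shift) (simp add: moebius_E_Some)
  have e3: "measure ?N {r. moebius (E 3) (Some r) \<in> ?A} = arc_mass ?\<phi> (x - 1) 0"
    by (rule inv) (simp add: moebius_E_Some)
  have e4: "measure ?N {r. moebius (E 4) (Some r) \<in> ?A} = arc_mass ?\<phi> (x + 1) 0"
    by (rule inv) (simp add: moebius_E_Some)
  have e5: "measure ?N {r. moebius (E 5) (Some r) \<in> ?A} = arc_mass ?\<phi> (x - 1) 1"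
    by (rule inv) (auto simp: moebius_E_Some field_simps)
  have e6: "measure ?N {r. moebius (E 6) (Some r) \<in> ?A} = arc_mass ?\<phi> (x + 1) (- 1)"
    by (rule inv) (auto simp: moebius_E_Some field_simps)
  have e7: "measure ?N {r. moebius (E 7) (Some r) \<in> ?A} = arc_mass ?\<phi> x 1"
    by (rule inv) (auto simp: moebius_E_Some field_simps)
  have e8: "measure ?N {r. moebius (E 8) (Some r) \<in> ?A} = arc_mass ?\<phi> x (- 1)"
    by (rule inv) (auto simp: moebius_E_Some field_simps)
  have "Some -` ?A = {x<..}" by auto
  then have "?\<phi> x = measure L ?A"
    using measure_real_part[OF L.finite_measure_axioms sets stationary_point_mass_eq_0[OF M st], of ?A]
    by (simp add: tail_def)
  then have "9 * ?\<phi> x = (\<Sum>i\<le>8. measure ?N {r. moebius (E i) (Some r) \<in> ?A})"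
    using stationary_measure_eq[OF M st A] by (simp add: m)
  then show "9 * ?\<phi> x = ?\<phi> (x - 1) + ?\<phi> (x + 1)
     + arc_mass ?\<phi> x 0 + arc_mass ?\<phi> (x - 1) 0 + arc_mass ?\<phi> (x + 1) 0
     + arc_mass ?\<phi> x 1 + arc_mass ?\<phi> x (- 1)
     + arc_mass ?\<phi> (x - 1) 1 + arc_mass ?\<phi> (x + 1) (- 1)"
    unfolding sum_atMost_8 e0 e1 e2 e3 e4 e5 e6 e7 e8 by simp
qed

theorem proposition3p5:
  fixes P :: "'w measure" and M :: "nat \<Rightarrow> 'w \<Rightarrow> real^2^2"
    and L :: "real option measure"
    and Q :: "'q measure" and X :: "'q \<Rightarrow> real option"
    and x :: real
  assumes "iid_uniform_E P M"
    and "stationary P M L"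
    and "prob_space Q"
    and "X \<in> Q \<rightarrow>\<^sub>M borel_RP1"
    and "distr Q borel_RP1 X = L"
    and "0 \<le> x"
  shows "measure Q {\<omega> \<in> space Q. \<exists>r. X \<omega> = Some r \<and> r > x} = 1 / 2 * denjoy_minkowski x \<and>
         measure Q {\<omega> \<in> space Q. \<exists>r. X \<omega> = Some r \<and> r < - x} = 1 / 2 * denjoy_minkowski x"
proof -
  let ?N = "real_part L"
  interpret L: prob_space L using assms(2) by (simp add: stationary_def)
  interpret N: atomless_distribution ?N by (rule stationary_atomless[OF assms(1,2)])
  have sets: "sets L = sets borel_RP1" using assms(2) by (simp add: stationary_def)
  have tail: "tail ?N = symmetric_tail denjoy_minkowski"
  proof (rule balanced_unique)
    show "balanced (tail ?N)" by (rule balanced_tail[OF assms(1,2)])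
    show "balanced (symmetric_tail denjoy_minkowski)"
      by (rule balanced_symmetric_tail)
        (simp_all add: denjoy_minkowski_0 denjoy_minkowski_add_1 denjoy_minkowski_inverse)
  qed (use N.continuous_tail N.tail_at_top N.tail_at_bot
         symmetric_tail_cdf_like[OF denjoy_minkowski_0 continuous_on_denjoy_minkowski denjoy_minkowski_at_top] in auto)
  have law: "measure Q {\<omega> \<in> space Q. \<exists>r. X \<omega> = Some r \<and> r \<in> B} = measure ?N B"
    if B: "B \<in> sets borel" for B
  proof -
    have "{\<omega> \<in> space Q. \<exists>r. X \<omega> = Some r \<and> r \<in> B} = X -` (Some ` B) \<inter> space Q" by auto
    then have "measure Q {\<omega> \<in> space Q. \<exists>r. X \<omega> = Some r \<and> r \<in> B} = measure L (Some ` B)"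
      using measure_distr[OF assms(4) Some_image_in_sets[OF B]] assms(5) by simp
    also have "\<dots> = measure ?N (Some -` (Some ` B))"
      by (rule measure_real_part[OF L.finite_measure_axioms sets stationary_point_mass_eq_0[OF assms(1,2)], symmetric])
        (simp add: inj_vimage_image_eq B)
    finally show ?thesis by (simp add: inj_vimage_image_eq)
  qed
  have "measure ?N {x<..} = 1 / 2 * denjoy_minkowski x"
    using assms(6) fun_cong[OF tail, of x] by (simp add: tail_def symmetric_tail_def)
  moreover have "measure ?N {..<- x} = 1 / 2 * denjoy_minkowski x"
    using N.measure_lessThan[of "- x"] fun_cong[OF tail, of "- x"] assms(6)
    by (cases "x = 0") (simp_all add: symmetric_tail_def denjoy_minkowski_0)
  ultimately show ?thesis using law[of "{x<..}"] law[of "{..<- x}"] by simp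
qed

end
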